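(* Let $\{G_n\}_{n=1}^\infty$ be a sequence of finite groups. For each $n\ge 1$ let $\nu_n$ and $\mu_n$ be two probability measures on $G_n$ such that the random walks on $G_n$ driven by them are irreducible, aperiodic and reversible. Assume that the random walk on $G_n$ driven by $\nu_n$ satisfies the (total variation) cutoff phenomenon at time $\tau_{\nu,n}$ with window of order $w_{\nu,n}$, and that it has limit profile $$f(c):=\lim_{n\to\infty}\left\|\nu_n^{*\lceil\tau_{\nu,n}+cw_{\nu,n}\rceil}-U_{G_n}\right\|_{\mathrm{TV}}\quad\text{for all }c\in\mathbb R .$$ If there exist real numbers $\tau_{\mu,n}$ and $w_{\mu,n}$ such that $w_{\mu,n}=o(\tau_{\mu,n})$ and, for every $c\in\mathbb R$, $$\lim_{n\to\infty}\sum_{\rho\in\widehat{G_n}}d_\rho\,\operatorname{trace}\left[\left(\big(\widehat{\nu_n}(\rho)\big)^{\lceil\tau_{\nu,n}+cw_{\nu,n}\rceil}-\big(\widehat{\mu_n}(\rho)\big)^{\lceil\tau_{\mu,n}+cw_{\mu,n}\rceil}\right)^2\right]=0 ,$$ then the random walk on $G_n$ driven by $\mu_n$ exhibits the (total variation) cutoff phenomenon at time $\tau_{\mu,n}$ with a window of order $w_{\mu,n}$; moreover, its limit profile is given by $f(c)$.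
   Context: For a probability measure $\gamma$ on a finite group $G$, the random walk on $G$ driven by $\gamma$ is the discrete-time Markov chain on $G$ with one-step transition probabilities $\mathbb P(X_1=y\mid X_0=x)=\gamma(x^{-1}y)$. When irreducible, its unique stationary distribution is the uniform measure $U_G$; it is reversible if and only if $\gamma(g)=\gamma(g^{-1})$ for all $g\in G$. Convolution is $\alpha*\beta(x)=\sum_{g\in G}\alpha(g)\beta(g^{-1}x)$, and $\gamma^{*k}$ is the $k$-fold self-convolution (the law after $k$ steps from the identity). $\|\mathcal P-\mathcal Q\|_{\mathrm{TV}}=\frac12\sum_{\omega}|\mathcal P(\omega)-\mathcal Q(\omega)|$. $\widehat G$ is the set of (isomorphism classes of) irreducible complex representations of $G$, $d_\rho$ is the dimension of $\rho$, and the Fourier transform of $\phi:G\to\mathbb R$ at $\rho$ is the operator $\widehat\phi(\rho)=\sum_{g\in G}\phi(g)\rho(g)$. Cutoff: for each $n$ let $\gamma_n$ be a probability measure on $G_n$ driving an irreducible aperiodic random walk. The sequence is said to satisfy the total variation cutoff phenomenon if there are sequences $\tau_n$ (cutoff time) and $w_n$ (cutoff window) such that $\tau_n\to\infty$, $w_n=o(\tau_n)$, $\lim_{c\to-\infty}\liminf_{n\to\infty}\|\gamma_n^{*\lceil\tau_n+cw_n\rceil}-U_{G_n}\|_{\mathrm{TV}}=1$ and $\lim_{c\to\infty}\limsup_{n\to\infty}\|\gamma_n^{*\lceil\tau_n+cw_n\rceil}-U_{G_n}\|_{\mathrm{TV}}=0$. Its limit profile is the function $c\mapsto\lim_{n\to\infty}\|\gamma_n^{*\lceil\tau_n+cw_n\rceil}-U_{G_n}\|_{\mathrm{TV}}$,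 provided the limit exists for each fixed $c\in\mathbb R$.
   Formalization: Cutoff for the walk driven by μ_n is concluded when τ_{μ,n} → ∞, which the stated hypotheses do not force; both total variation limits at time τ_{μ,n} with window w_{μ,n}, and the limit profile f(c), are proved without that condition. *)

theory Defs
  imports
    "HOL-Probability.Probability_Mass_Function"
    "HOL-Library.Landau_Symbols"
    "HOL-Algebra.Group"
    "Jordan_Normal_Form.VS_Connect"
begin

section \<open>Markov chains on a finite state space\<close>

text \<open>A chain on \<open>S\<close> is given by its transition probabilities \<open>P x y\<close>; only the
  values for \<open>x, y \<in> S\<close> matter.\<close>

fun kernel_pow :: "'a set \<Rightarrow> ('a \<Rightarrow> 'a \<Rightarrow> real) \<Rightarrow> nat \<Rightarrow> 'a \<Rightarrow> 'a \<Rightarrow> real" where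
  "kernel_pow S P 0 x y = (if x = y then 1 else 0)"
| "kernel_pow S P (Suc k) x y = (\<Sum>z\<in>S. kernel_pow S P k x z * P z y)"

definition irreducible_chain :: "'a set \<Rightarrow> ('a \<Rightarrow> 'a \<Rightarrow> real) \<Rightarrow> bool" where
  "irreducible_chain S P \<longleftrightarrow> (\<forall>x\<in>S. \<forall>y\<in>S. \<exists>k. kernel_pow S P k x y > 0)"

definition aperiodic_chain :: "'a set \<Rightarrow> ('a \<Rightarrow> 'a \<Rightarrow> real) \<Rightarrow> bool" where
  "aperiodic_chain S P \<longleftrightarrow> (\<forall>x\<in>S. Gcd {k. k \<ge> 1 \<and> kernel_pow S P k x x > 0} = 1)"

text \<open>Detailed balance with respect to some probability distribution \<open>\<pi>\<close> on \<open>S\<close>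
  (which is then stationary, and is the only stationary distribution when the
  chain is irreducible).\<close>

definition reversible_chain :: "'a set \<Rightarrow> ('a \<Rightarrow> 'a \<Rightarrow> real) \<Rightarrow> bool" where
  "reversible_chain S P \<longleftrightarrow>
     (\<exists>\<pi>. (\<forall>x\<in>S. \<pi> x \<ge> 0) \<and> (\<Sum>x\<in>S. \<pi> x) = 1 \<and>
          (\<forall>x\<in>S. \<forall>y\<in>S. \<pi> x * P x y = \<pi> y * P y x))"


section \<open>Random walks on finite groups\<close>

definition walk_kernel :: "'a monoid \<Rightarrow> 'a pmf \<Rightarrow> 'a \<Rightarrow> 'a \<Rightarrow> real" where
  "walk_kernel G \<gamma> x y = pmf \<gamma> (inv\<^bsub>G\<^esub> x \<otimes>\<^bsub>G\<^esub> y)"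

definition convol :: "'a monoid \<Rightarrow> ('a \<Rightarrow> real) \<Rightarrow> ('a \<Rightarrow> real) \<Rightarrow> 'a \<Rightarrow> real" where
  "convol G \<alpha> \<beta> x = (\<Sum>g\<in>carrier G. \<alpha> g * \<beta> (inv\<^bsub>G\<^esub> g \<otimes>\<^bsub>G\<^esub> x))"

fun convol_pow :: "'a monoid \<Rightarrow> ('a \<Rightarrow> real) \<Rightarrow> nat \<Rightarrow> 'a \<Rightarrow> real" where
  "convol_pow G \<gamma> 0 = (\<lambda>x. if x = \<one>\<^bsub>G\<^esub> then 1 else 0)"
| "convol_pow G \<gamma> (Suc k) = convol G (convol_pow G \<gamma> k) \<gamma>"

definition tv_dist :: "'a set \<Rightarrow> ('a \<Rightarrow> real) \<Rightarrow> ('a \<Rightarrow> real) \<Rightarrow> real" where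
  "tv_dist \<Omega> p q = (1/2) * (\<Sum>\<omega>\<in>\<Omega>. \<bar>p \<omega> - q \<omega>\<bar>)"

definition walk_tv :: "'a monoid \<Rightarrow> 'a pmf \<Rightarrow> nat \<Rightarrow> real" where
  "walk_tv G \<gamma> k =
     tv_dist (carrier G) (convol_pow G (pmf \<gamma>) k) (pmf (pmf_of_set (carrier G)))"


section \<open>Cutoff\<close>

text \<open>The number of steps \<open>\<lceil>\<tau>\<^sub>n + c w\<^sub>n\<rceil>\<close>, truncated to \<open>0\<close> when negative. If
  \<open>\<tau>\<^sub>n \<rightarrow> \<infinity>\<close> and \<open>w\<^sub>n = o(\<tau>\<^sub>n)\<close>, then for each fixed \<open>c\<close> truncation affects only
  finitely many \<open>n\<close>.\<close>

definition cutoff_step :: "(nat \<Rightarrow> real) \<Rightarrow> (nat \<Rightarrow> real) \<Rightarrow> real \<Rightarrow> nat \<Rightarrow> nat" where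
  "cutoff_step \<tau> w c n = nat \<lceil>\<tau> n + c * w n\<rceil>"

text \<open>Cutoff is split into the total variation clauses and the growth conditions on
  \<open>\<tau>\<close> and \<open>w\<close>, because the total variation clauses and the limit profile can hold
  with \<open>\<tau>\<^sub>n\<close> bounded: if \<open>\<tau>\<^sub>n = 1\<close> and \<open>w\<^sub>n = 1/n\<close>, the step counts for fixed \<open>c\<close> are
  eventually \<open>1\<close> (\<open>c \<le> 0\<close>) or \<open>2\<close> (\<open>c > 0\<close>).\<close>

definition tv_transition ::
  "(nat \<Rightarrow> 'a monoid) \<Rightarrow> (nat \<Rightarrow> 'a pmf) \<Rightarrow> (nat \<Rightarrow> real) \<Rightarrow> (nat \<Rightarrow> real) \<Rightarrow> bool" where
  "tv_transition G \<gamma> \<tau> w \<longleftrightarrow>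
     ((\<lambda>c. liminf (\<lambda>n. ereal (walk_tv (G n) (\<gamma> n) (cutoff_step \<tau> w c n)))) \<longlongrightarrow> 1) at_bot \<and>
     ((\<lambda>c. limsup (\<lambda>n. ereal (walk_tv (G n) (\<gamma> n) (cutoff_step \<tau> w c n)))) \<longlongrightarrow> 0) at_top"

definition tv_cutoff ::
  "(nat \<Rightarrow> 'a monoid) \<Rightarrow> (nat \<Rightarrow> 'a pmf) \<Rightarrow> (nat \<Rightarrow> real) \<Rightarrow> (nat \<Rightarrow> real) \<Rightarrow> bool" where
  "tv_cutoff G \<gamma> \<tau> w \<longleftrightarrow>
     filterlim \<tau> at_top sequentially \<and> w \<in> o(\<tau>) \<and> tv_transition G \<gamma> \<tau> w"

definition has_limit_profile ::
  "(nat \<Rightarrow> 'a monoid) \<Rightarrow> (nat \<Rightarrow> 'a pmf) \<Rightarrow> (nat \<Rightarrow> real) \<Rightarrow> (nat \<Rightarrow> real) \<Rightarrow> (real \<Rightarrow> real) \<Rightarrow> bool" where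
  "has_limit_profile G \<gamma> \<tau> w f \<longleftrightarrow>
     (\<forall>c. (\<lambda>n. walk_tv (G n) (\<gamma> n) (cutoff_step \<tau> w c n)) \<longlonglongrightarrow> f c)"


section \<open>Complex representations and the Fourier transform\<close>

text \<open>Representations are taken on the spaces \<open>\<complex>\<^sup>d\<close>, i.e. they are matrix valued; the
  dimension \<open>d\<close> is read off from the size of the matrices. Values outside the
  carrier of the group are irrelevant.\<close>

definition rep_dim :: "'a monoid \<Rightarrow> ('a \<Rightarrow> complex mat) \<Rightarrow> nat" where
  "rep_dim G \<rho> = dim_row (\<rho> \<one>\<^bsub>G\<^esub>)"

definition representation :: "'a monoid \<Rightarrow> ('a \<Rightarrow> complex mat) \<Rightarrow> bool" where
  "representation G \<rho> \<longleftrightarrow>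
     (\<forall>g\<in>carrier G. \<rho> g \<in> carrier_mat (rep_dim G \<rho>) (rep_dim G \<rho>)) \<and>
     \<rho> \<one>\<^bsub>G\<^esub> = 1\<^sub>m (rep_dim G \<rho>) \<and>
     (\<forall>g\<in>carrier G. \<forall>h\<in>carrier G. \<rho> (g \<otimes>\<^bsub>G\<^esub> h) = \<rho> g * \<rho> h)"

definition irreducible_rep :: "'a monoid \<Rightarrow> ('a \<Rightarrow> complex mat) \<Rightarrow> bool" where
  "irreducible_rep G \<rho> \<longleftrightarrow>
     representation G \<rho> \<and> rep_dim G \<rho> > 0 \<and>
     (\<forall>W. VectorSpace.subspace class_ring W (module_vec TYPE(complex) (rep_dim G \<rho>)) \<and>
          (\<forall>g\<in>carrier G. \<forall>v\<in>W. \<rho> g *\<^sub>v v \<in> W) \<longrightarrow>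
          W = {0\<^sub>v (rep_dim G \<rho>)} \<or> W = carrier_vec (rep_dim G \<rho>))"

definition equivalent_reps ::
  "'a monoid \<Rightarrow> ('a \<Rightarrow> complex mat) \<Rightarrow> ('a \<Rightarrow> complex mat) \<Rightarrow> bool" where
  "equivalent_reps G \<rho> \<sigma> \<longleftrightarrow>
     rep_dim G \<rho> = rep_dim G \<sigma> \<and>
     (\<exists>T\<in>carrier_mat (rep_dim G \<rho>) (rep_dim G \<rho>). invertible_mat T \<and>
        (\<forall>g\<in>carrier G. T * \<rho> g = \<sigma> g * T))"

definition irreps :: "'a monoid \<Rightarrow> ('a \<Rightarrow> complex mat) set set" where
  "irreps G = {\<rho>. irreducible_rep G \<rho>} //
     {(\<rho>, \<sigma>). irreducible_rep G \<rho> \<and> irreducible_rep G \<sigma> \<and> equivalent_reps G \<rho> \<sigma>}"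

text \<open>A representative of an isomorphism class. Dimensions, and traces of polynomials
  in Fourier transforms, do not depend on the choice.\<close>

definition rep_of :: "('a \<Rightarrow> complex mat) set \<Rightarrow> 'a \<Rightarrow> complex mat" where
  "rep_of C = (SOME \<rho>. \<rho> \<in> C)"

definition fourier :: "'a monoid \<Rightarrow> ('a \<Rightarrow> real) \<Rightarrow> ('a \<Rightarrow> complex mat) \<Rightarrow> complex mat" where
  "fourier G \<phi> \<rho> = mat (rep_dim G \<rho>) (rep_dim G \<rho>)
     (\<lambda>(i, j). \<Sum>g\<in>carrier G. complex_of_real (\<phi> g) * \<rho> g $$ (i, j))"

definition mat_trace :: "complex mat \<Rightarrow> complex" where
  "mat_trace A = (\<Sum>i<dim_row A. A $$ (i, i))"

end

theory Submission
  imports Defs "Jordan_Normal_Form.Spectral_Radius"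
begin

text \<open>
  Fix \<open>c\<close> and \<open>n\<close>, let \<open>k\<close> and \<open>l\<close> be the two numbers of steps, and put
  \<open>\<phi> = \<nu>\<^sup>*\<^sup>k - \<mu>\<^sup>*\<^sup>l\<close>. The distances to uniformity of the two walks differ by at most
  \<open>\<parallel>\<phi>\<parallel>\<^sub>1/2\<close>, which by the Cauchy-Schwarz inequality is at most
  \<open>(|G| \<Sum>\<^sub>g \<phi>(g)\<^sup>2)\<^sup>1\<^sup>/\<^sup>2/2\<close> (lemma \<open>tv_dist_diff_le\<close>). Reversibility of an irreducible walk
  means that its step distribution is symmetric (\<open>reversible_walk_symmetric\<close>), so \<open>\<phi>\<close> is
  symmetric, and Plancherel's formula (\<open>plancherel_symmetric\<close>) identifies
  \<open>|G| \<Sum>\<^sub>g \<phi>(g)\<^sup>2\<close> with the sum over the irreducible representations in the hypothesis.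
  As that sum tends to zero, the two walks have the same limit profile, and liminf and limsup
  in the definition of cutoff are both the value of the profile.

  Plancherel's formula is the identity \<open>\<Sum>\<^sub>\<rho> d\<^sub>\<rho> \<chi>\<^sub>\<rho>(g) = |G| [g = 1]\<close>
  (\<open>regular_character\<close>), applied to \<open>\<phi> * \<phi>\<close>. Schur orthogonality shows that the two sides have the
  same Fourier transform (\<open>entry_character_orthogonality\<close>), and a function on \<open>G\<close> is determined by
  its Fourier transform (\<open>fourier_injective\<close>). The last fact replaces complete reducibility:
  a nonzero function with vanishing transform would give a nonzero invariant
  subspace of the regular representation all of whose elements are orthogonal to the matrix
  coefficients \<open>g \<mapsto> \<sigma>(g\<^sup>-\<^sup>1)\<^sub>i\<^sub>j\<close> of irreducible representations, whereas the elements of an irreducible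
  invariant subspace are themselves combinations of such coefficients.
\<close>

hide_const (open) Determinants.det Finite_Cartesian_Product.mat Finite_Cartesian_Product.vec
unbundle no vec_syntax

section \<open>Linear algebra with injective matrices\<close>

text \<open>
  Subspaces of \<open>K\<^sup>n\<close> are handled through matrices whose columns form a basis. This
  predicate is linear independence of the columns.
\<close>

definition inj_cols :: "'a :: field mat \<Rightarrow> bool" where
  "inj_cols P \<longleftrightarrow> (\<forall>v\<in>carrier_vec (dim_col P). P *\<^sub>v v = 0\<^sub>v (dim_row P) \<longrightarrow> v = 0\<^sub>v (dim_col P))"

lemma inj_colsD:
  assumes "inj_cols P" "P \<in> carrier_mat n m" "v \<in> carrier_vec m" "P *\<^sub>v v = 0\<^sub>v n"
  shows "v = 0\<^sub>v m"
  using assms by (auto simp: inj_cols_def)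

lemma mat_vec_sum:
  assumes "A \<in> carrier_mat n m" "v \<in> carrier_vec m" "i < n"
  shows "(A *\<^sub>v v) $ i = (\<Sum>j<m. A $$ (i,j) * v $ j)"
  using assms by (simp add: scalar_prod_def row_def lessThan_atLeast0)

lemma mat_mult_sum:
  assumes "A \<in> carrier_mat n m" "B \<in> carrier_mat m k" "i < n" "j < k"
  shows "(A * B) $$ (i,j) = (\<Sum>l<m. A $$ (i,l) * B $$ (l,j))"
  using assms by (simp add: scalar_prod_def row_def col_def lessThan_atLeast0)

lemma mult_mat_vec_zero:
  assumes "A \<in> carrier_mat n m" shows "A *\<^sub>v 0\<^sub>v m = 0\<^sub>v n"
  using assms by (intro eq_vecI) (auto simp: scalar_prod_def)

lemma inj_cols_left_inverse:
  assumes Y: "Y \<in> carrier_mat m n" and Z: "Z \<in> carrier_mat n m" and YZ: "Y * Z = 1\<^sub>m m"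
  shows "inj_cols Z"
  unfolding inj_cols_def
proof (intro ballI impI)
  fix v assume v: "v \<in> carrier_vec (dim_col Z)" and z: "Z *\<^sub>v v = 0\<^sub>v (dim_row Z)"
  have v': "v \<in> carrier_vec m" using v Z by simp
  have "v = (Y * Z) *\<^sub>v v" using v' YZ by simp
  also have "\<dots> = Y *\<^sub>v (Z *\<^sub>v v)" by (rule assoc_mult_mat_vec[OF Y Z v'])
  also have "\<dots> = Y *\<^sub>v 0\<^sub>v n" using z Z by simp
  also have "\<dots> = 0\<^sub>v m" by (rule mult_mat_vec_zero[OF Y])
  finally show "v = 0\<^sub>v (dim_col Z)" using Z by simp
qed

lemma inj_cols_mult:
  assumes P: "P \<in> carrier_mat n m" "inj_cols P" and Q: "Q \<in> carrier_mat m k" "inj_cols Q"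
  shows "inj_cols (P * Q)"
  unfolding inj_cols_def
proof (intro ballI impI)
  fix v assume v: "v \<in> carrier_vec (dim_col (P * Q))" and z: "P * Q *\<^sub>v v = 0\<^sub>v (dim_row (P * Q))"
  have v': "v \<in> carrier_vec k" using v Q by simp
  have "P *\<^sub>v (Q *\<^sub>v v) = 0\<^sub>v n" using z P Q v' by simp
  hence "Q *\<^sub>v v = 0\<^sub>v m" using inj_colsD[OF P(2,1)] Q v' by auto
  thus "v = 0\<^sub>v (dim_col (P * Q))" using inj_colsD[OF Q(2,1) v'] Q by simp
qed

lemma inj_cols_cancel:
  assumes P: "P \<in> carrier_mat n m" "inj_cols P"
    and A: "A \<in> carrier_mat m k" and B: "B \<in> carrier_mat m k" and eq: "P * A = P * B"
  shows "A = B"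
proof (rule eq_matI)
  fix i j assume ij: "i < dim_row B" "j < dim_col B"
  hence i: "i < m" and j: "j < k" using B by auto
  have cA: "col A j \<in> carrier_vec m" and cB: "col B j \<in> carrier_vec m"
    using A B by (auto intro!: carrier_vecI)
  have "col (P * A) j = col (P * B) j" by (simp only: eq)
  hence "P *\<^sub>v col A j = P *\<^sub>v col B j" using col_mult2[OF P(1) A j] col_mult2[OF P(1) B j] by simp
  moreover have "P *\<^sub>v col B j \<in> carrier_vec n" using P(1) by (auto intro!: carrier_vecI)
  ultimately have "P *\<^sub>v (col A j - col B j) = 0\<^sub>v n"
    by (simp add: mult_minus_distrib_mat_vec[OF P(1) cA cB])
  moreover have "col A j - col B j \<in> carrier_vec m" using cA cB by simp
  ultimately have z: "col A j - col B j = 0\<^sub>v m" using inj_colsD[OF P(2,1)] by blast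
  have "(col A j - col B j) $ i = 0" unfolding z using i by simp
  thus "A $$ (i,j) = B $$ (i,j)" using A B i j by simp
qed (use A B in auto)

text \<open>
  If there were more columns than rows, padding with zero rows would give a square
  matrix that is still injective but has determinant zero.
\<close>

lemma inj_cols_le:
  assumes P: "P \<in> carrier_mat n m" and inj: "inj_cols P"
  shows "m \<le> n"
proof (rule ccontr)
  assume "\<not> m \<le> n"
  hence nm: "n < m" by simp
  define Q where "Q = mat m m (\<lambda>(i,j). if i < n then P $$ (i,j) else 0)"
  have Q: "Q \<in> carrier_mat m m" by (simp add: Q_def)
  \<comment> \<open>Row \<open>n\<close> of the padded square matrix vanishes, so the transpose fourier_vanishes a unit vector.\<close>
  have "transpose_mat Q *\<^sub>v unit_vec m n = 0\<^sub>v m"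
  proof (rule eq_vecI)
    fix i assume "i < dim_vec (0\<^sub>v m :: 'a vec)"
    hence i: "i < m" by simp
    have "(transpose_mat Q *\<^sub>v unit_vec m n) $ i = (\<Sum>j<m. Q $$ (j,i) * (if j = n then 1 else 0))"
      using i Q by (subst mat_vec_sum[where n = m and m = m]) (auto simp: unit_vec_def)
    also have "\<dots> = 0" using nm i by (simp add: Q_def)
    finally show "(transpose_mat Q *\<^sub>v unit_vec m n) $ i = 0\<^sub>v m $ i" using i by simp
  qed (use Q in auto)
  hence "det (transpose_mat Q) = 0"
    using det_0_iff_vec_prod_zero_field[of "transpose_mat Q" m] Q nm
    by (metis unit_vec_carrier unit_vec_nonzero transpose_carrier_mat)
  hence "det Q = 0" using det_transpose[OF Q] by simp
  then obtain v where v: "v \<in> carrier_vec m" "v \<noteq> 0\<^sub>v m" "Q *\<^sub>v v = 0\<^sub>v m"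
    using det_0_iff_vec_prod_zero_field[OF Q] by auto
  have "P *\<^sub>v v = 0\<^sub>v n"
  proof (rule eq_vecI)
    fix i assume "i < dim_vec (0\<^sub>v n)"
    hence i: "i < n" by simp
    have "(P *\<^sub>v v) $ i = (Q *\<^sub>v v) $ i"
      unfolding mat_vec_sum[OF P v(1) i] mat_vec_sum[OF Q v(1) less_trans[OF i nm]]
      using i nm by (intro sum.cong) (auto simp: Q_def)
    thus "(P *\<^sub>v v) $ i = 0\<^sub>v n $ i" using v(3) i nm by simp
  qed (use P in auto)
  thus False using inj_colsD[OF inj P v(1)] v(2) by simp
qed

lemma inj_cols_square_inverse:
  assumes P: "P \<in> carrier_mat n n" and inj: "inj_cols P"
  obtains R where "R \<in> carrier_mat n n" "P * R = 1\<^sub>m n" "R * P = 1\<^sub>m n"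
proof -
  have "det P \<noteq> 0" using det_0_iff_vec_prod_zero_field[OF P] inj_colsD[OF inj P] by auto
  from det_non_zero_imp_unit[OF P this, of "()"] show ?thesis
    using that by (auto simp: Units_def ring_mat_simps)
qed

definition lin_subspace :: "nat \<Rightarrow> 'a :: field vec set \<Rightarrow> bool" where
  "lin_subspace n W \<longleftrightarrow> W \<subseteq> carrier_vec n \<and> 0\<^sub>v n \<in> W \<and>
     (\<forall>v\<in>W. \<forall>w\<in>W. v + w \<in> W) \<and> (\<forall>c. \<forall>v\<in>W. c \<cdot>\<^sub>v v \<in> W)"

text \<open>
  Unfolds the subspaces in the definition of irreducibility into closure conditions.
\<close>

lemma subspace_module_vec_iff:
  "VectorSpace.subspace class_ring W (module_vec TYPE(complex) n) \<longleftrightarrow> lin_subspace n W"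
  using vec_vs[where 'a = complex, of n] vec_module[where 'a = complex, of n]
  by (auto simp: subspace_def submodule_def lin_subspace_def module_vec_simps)

lemma append_column:
  fixes w :: "'a :: field vec"
  assumes Q: "Q \<in> carrier_mat n m" and w: "w \<in> carrier_vec n" and v: "v \<in> carrier_vec (Suc m)"
  shows "mat n (Suc m) (\<lambda>(i,j). if j < m then Q $$ (i,j) else w $ i) *\<^sub>v v
       = Q *\<^sub>v vec m (\<lambda>j. v $ j) + v $ m \<cdot>\<^sub>v w" (is "?A *\<^sub>v v = _")
proof (rule eq_vecI)
  have A: "?A \<in> carrier_mat n (Suc m)" by simp
  fix i assume "i < dim_vec (Q *\<^sub>v vec m (\<lambda>j. v $ j) + v $ m \<cdot>\<^sub>v w)"
  hence i: "i < n" using w by simp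
  show "(?A *\<^sub>v v) $ i = (Q *\<^sub>v vec m (\<lambda>j. v $ j) + v $ m \<cdot>\<^sub>v w) $ i"
    using i w by (simp add: mat_vec_sum[OF A v i] mat_vec_sum[OF Q _ i] mult.commute[of "w $ i"] del: index_mult_mat_vec)
qed (use w in auto)

text \<open>
  Take an injective matrix with columns in the subspace and as many columns as
  possible (at most \<open>n\<close> by \<open>inj_cols_le\<close>): a vector of the subspace outside the range could be
  appended as a further column.
\<close>

lemma lin_subspace_column_basis:
  assumes W: "lin_subspace n W"
  obtains m Q where "m \<le> n" "Q \<in> carrier_mat n m" "inj_cols Q"
    "W = (\<lambda>v. Q *\<^sub>v v) ` carrier_vec m" "m = n \<Longrightarrow> W = carrier_vec n"
proof -
  have Wc: "W \<subseteq> carrier_vec n" and W0: "0\<^sub>v n \<in> W" and Wa: "\<And>v w. v \<in> W \<Longrightarrow> w \<in> W \<Longrightarrow> v + w \<in> W"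
    and Ws: "\<And>c v. v \<in> W \<Longrightarrow> c \<cdot>\<^sub>v v \<in> W"
    using W by (auto simp: lin_subspace_def)
  define good where "good m \<longleftrightarrow> (\<exists>Q\<in>carrier_mat n m. inj_cols Q \<and> (\<forall>v\<in>carrier_vec m. Q *\<^sub>v v \<in> W))" for m
  have "good 0"
    unfolding good_def
  proof (intro bexI[of _ "0\<^sub>m n 0"] conjI ballI)
    fix v :: "'a vec" assume v: "v \<in> carrier_vec 0"
    have "0\<^sub>m n 0 *\<^sub>v v = 0\<^sub>v n" by (rule eq_vecI) (use v in \<open>auto simp: scalar_prod_def\<close>)
    thus "0\<^sub>m n 0 *\<^sub>v v \<in> W" using W0 by simp
  qed (auto simp: inj_cols_def)
  moreover have bnd: "m \<le> n" if "good m" for m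
    using that inj_cols_le unfolding good_def by blast
  ultimately obtain m where m: "good m" and mx: "\<And>k. good k \<Longrightarrow> k \<le> m"
    using Nat.ex_has_greatest_nat[of good 0 n] by blast
  then obtain Q where Q: "Q \<in> carrier_mat n m" "inj_cols Q" "\<And>v. v \<in> carrier_vec m \<Longrightarrow> Q *\<^sub>v v \<in> W"
    unfolding good_def by blast
  have range: "w \<in> (\<lambda>v. Q *\<^sub>v v) ` carrier_vec m" if w: "w \<in> W" for w
  proof (rule ccontr)
    assume nr: "w \<notin> (\<lambda>v. Q *\<^sub>v v) ` carrier_vec m"
    have wc: "w \<in> carrier_vec n" using w Wc by auto
    define A where "A = mat n (Suc m) (\<lambda>(i,j). if j < m then Q $$ (i,j) else w $ i)"
    have A: "A \<in> carrier_mat n (Suc m)" by (simp add: A_def)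
    have Av: "A *\<^sub>v v = Q *\<^sub>v vec m (\<lambda>j. v $ j) + v $ m \<cdot>\<^sub>v w" if "v \<in> carrier_vec (Suc m)" for v
      unfolding A_def by (rule append_column[OF Q(1) wc that])
    have "inj_cols A" unfolding inj_cols_def
    proof (intro ballI impI)
      fix v assume "v \<in> carrier_vec (dim_col A)" "A *\<^sub>v v = 0\<^sub>v (dim_row A)"
      hence v: "v \<in> carrier_vec (Suc m)" and z: "A *\<^sub>v v = 0\<^sub>v n" using A by auto
      let ?u = "vec m (\<lambda>j. v $ j)"
      have u: "?u \<in> carrier_vec m" by simp
      have eq: "Q *\<^sub>v ?u + v $ m \<cdot>\<^sub>v w = 0\<^sub>v n" using z Av[OF v] by simp
      have eqi: "(Q *\<^sub>v ?u) $ i + v $ m * w $ i = 0" if "i < n" for i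
        using arg_cong[OF eq, of "\<lambda>x. x $ i"] that wc Q(1) by auto
      have vm: "v $ m = 0"
      proof (rule ccontr)
        assume nz: "v $ m \<noteq> 0"
        have "w = Q *\<^sub>v ((- 1 / v $ m) \<cdot>\<^sub>v ?u)"
        proof (rule eq_vecI)
          fix i assume "i < dim_vec (Q *\<^sub>v ((- 1 / v $ m) \<cdot>\<^sub>v ?u))"
          hence i: "i < n" using Q(1) by simp
          have "(Q *\<^sub>v ((- 1 / v $ m) \<cdot>\<^sub>v ?u)) $ i = (- 1 / v $ m) * (Q *\<^sub>v ?u) $ i"
            using mult_mat_vec[OF Q(1) u] i Q(1) by simp
          also have "(Q *\<^sub>v ?u) $ i = - (v $ m * w $ i)" using eqi[OF i] by (simp add: eq_neg_iff_add_eq_0)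
          finally show "w $ i = (Q *\<^sub>v ((- 1 / v $ m) \<cdot>\<^sub>v ?u)) $ i" using nz by simp
        qed (use wc Q in auto)
        thus False using nr by auto
      qed
      have "Q *\<^sub>v ?u = 0\<^sub>v n" by (rule eq_vecI) (use eqi vm Q(1) in auto)
      hence "?u = 0\<^sub>v m" by (rule inj_colsD[OF Q(2,1) u])
      hence "v $ j = 0" if "j < m" for j using that by (metis index_vec index_zero_vec(1))
      thus "v = 0\<^sub>v (dim_col A)" using A v vm by (intro eq_vecI) (auto simp: less_Suc_eq)
    qed
    moreover have "A *\<^sub>v v \<in> W" if "v \<in> carrier_vec (Suc m)" for v
      unfolding Av[OF that] by (intro Wa Ws Q(3) w) auto
    ultimately have "good (Suc m)" unfolding good_def using A by blast
    thus False using mx[of "Suc m"] by simp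
  qed
  show ?thesis
  proof (rule that[OF bnd[OF m] Q(1,2)])
    show W': "W = (\<lambda>v. Q *\<^sub>v v) ` carrier_vec m" using range Q(3) by auto
    assume mn: "m = n"
    then obtain R where R: "R \<in> carrier_mat n n" "Q * R = 1\<^sub>m n"
      using inj_cols_square_inverse Q by metis
    have "x \<in> W" if x: "x \<in> carrier_vec n" for x
    proof -
      have "x = Q *\<^sub>v (R *\<^sub>v x)"
        using Q(1) R x mn by (metis assoc_mult_mat_vec one_mult_mat_vec)
      moreover have "R *\<^sub>v x \<in> carrier_vec m" using R x mn by simp
      ultimately show ?thesis using Q(3) by metis
    qed
    thus "W = carrier_vec n" using Wc by auto
  qed
qed

section \<open>Schur's lemma\<close>

lemma representationD:
  assumes "representation G \<rho>"
  shows "g \<in> carrier G \<Longrightarrow> \<rho> g \<in> carrier_mat (rep_dim G \<rho>) (rep_dim G \<rho>)"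
    and "\<rho> \<one>\<^bsub>G\<^esub> = 1\<^sub>m (rep_dim G \<rho>)"
    and "g \<in> carrier G \<Longrightarrow> h \<in> carrier G \<Longrightarrow> \<rho> (g \<otimes>\<^bsub>G\<^esub> h) = \<rho> g * \<rho> h"
  using assms by (auto simp: representation_def)

lemma irreducible_repD:
  assumes "irreducible_rep G \<rho>"
  shows "representation G \<rho>" and "rep_dim G \<rho> > 0"
    and "lin_subspace (rep_dim G \<rho>) W \<Longrightarrow> (\<And>g v. g \<in> carrier G \<Longrightarrow> v \<in> W \<Longrightarrow> \<rho> g *\<^sub>v v \<in> W) \<Longrightarrow>
           W = {0\<^sub>v (rep_dim G \<rho>)} \<or> W = carrier_vec (rep_dim G \<rho>)"
  using assms by (auto simp: irreducible_rep_def subspace_module_vec_iff)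

lemma mat_mult_unit_vec:
  fixes A :: "'a :: field mat"
  assumes A: "A \<in> carrier_mat n m" and j: "j < m"
  shows "A *\<^sub>v unit_vec m j = col A j"
  using A j by (intro eq_vecI) (auto intro: carrier_vecI)

text \<open>
  Kernel and range of an intertwiner are invariant, so if it is not zero then
  irreducibility makes it injective and surjective.
\<close>

lemma schur_zero_or_equivalent:
  assumes \<rho>: "irreducible_rep G \<rho>" and \<sigma>: "irreducible_rep G \<sigma>"
    and Y: "Y \<in> carrier_mat (rep_dim G \<sigma>) (rep_dim G \<rho>)"
    and com: "\<And>g. g \<in> carrier G \<Longrightarrow> \<sigma> g * Y = Y * \<rho> g"
  shows "Y = 0\<^sub>m (rep_dim G \<sigma>) (rep_dim G \<rho>) \<or> equivalent_reps G \<rho> \<sigma>"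
proof -
  let ?d = "rep_dim G \<rho>" and ?e = "rep_dim G \<sigma>"
  note \<rho>c = representationD(1)[OF irreducible_repD(1)[OF \<rho>]]
  note \<sigma>c = representationD(1)[OF irreducible_repD(1)[OF \<sigma>]]
  have com': "Y *\<^sub>v (\<rho> g *\<^sub>v v) = \<sigma> g *\<^sub>v (Y *\<^sub>v v)" if "g \<in> carrier G" "v \<in> carrier_vec ?d" for g v
    using com[OF that(1)] Y \<rho>c[OF that(1)] \<sigma>c[OF that(1)] that(2)
    by (metis assoc_mult_mat_vec)
  define K where "K = {v \<in> carrier_vec ?d. Y *\<^sub>v v = 0\<^sub>v ?e}"
  define I where "I = (\<lambda>v. Y *\<^sub>v v) ` carrier_vec ?d"
  have "lin_subspace ?d K" unfolding lin_subspace_def K_def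
    using Y by (auto simp: mult_add_distrib_mat_vec[OF Y] mult_mat_vec[OF Y] mult_mat_vec_zero)
  moreover have "\<rho> g *\<^sub>v v \<in> K" if "g \<in> carrier G" "v \<in> K" for g v
    using that com'[OF that(1), of v] \<rho>c[OF that(1)] mult_mat_vec_zero[OF \<sigma>c[OF that(1)]]
    by (auto simp: K_def)
  ultimately have K: "K = {0\<^sub>v ?d} \<or> K = carrier_vec ?d"
    by (rule irreducible_repD(3)[OF \<rho>])
  have "lin_subspace ?e I" unfolding lin_subspace_def
  proof (intro conjI ballI allI)
    show "I \<subseteq> carrier_vec ?e" using Y by (auto simp: I_def)
    show "0\<^sub>v ?e \<in> I" unfolding I_def using mult_mat_vec_zero[OF Y] by (intro image_eqI[of _ _ "0\<^sub>v ?d"]) auto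
    show "v + w \<in> I" if vw: "v \<in> I" "w \<in> I" for v w
    proof -
      obtain x y where xy: "x \<in> carrier_vec ?d" "v = Y *\<^sub>v x" "y \<in> carrier_vec ?d" "w = Y *\<^sub>v y"
        using vw unfolding I_def by blast
      show ?thesis unfolding I_def
        by (rule image_eqI[of _ _ "x + y"]) (use xy in \<open>simp_all add: mult_add_distrib_mat_vec[OF Y]\<close>)
    qed
    show "c \<cdot>\<^sub>v v \<in> I" if vI: "v \<in> I" for v c
    proof -
      obtain x where x: "x \<in> carrier_vec ?d" "v = Y *\<^sub>v x" using vI unfolding I_def by blast
      show ?thesis unfolding I_def
        by (rule image_eqI[of _ _ "c \<cdot>\<^sub>v x"]) (use x in \<open>simp_all add: mult_mat_vec[OF Y]\<close>)
    qed
  qed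
  moreover have "\<sigma> g *\<^sub>v v \<in> I" if g: "g \<in> carrier G" and v: "v \<in> I" for g v
  proof -
    obtain x where x: "x \<in> carrier_vec ?d" "v = Y *\<^sub>v x" using v unfolding I_def by blast
    show ?thesis unfolding I_def
      by (rule image_eqI[of _ _ "\<rho> g *\<^sub>v x"]) (use x com'[OF g x(1)] \<rho>c[OF g] in auto)
  qed
  ultimately have I: "I = {0\<^sub>v ?e} \<or> I = carrier_vec ?e"
    by (rule irreducible_repD(3)[OF \<sigma>])
  show ?thesis
  proof (cases "Y = 0\<^sub>m ?e ?d")
    case False
    have nz: "\<exists>v\<in>carrier_vec ?d. Y *\<^sub>v v \<noteq> 0\<^sub>v ?e"
    proof (rule ccontr)
      assume "\<not> ?thesis"
      hence "col Y j = 0\<^sub>v ?e" if "j < ?d" for j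
        using mat_mult_unit_vec[OF Y that] by (metis unit_vec_carrier)
      hence "Y $$ (i,j) = 0" if "i < ?e" "j < ?d" for i j
        using Y that by (metis carrier_matD index_col index_zero_vec(1))
      hence "Y = 0\<^sub>m ?e ?d" using Y by (intro eq_matI) auto
      thus False using False by simp
    qed
    hence "K \<noteq> carrier_vec ?d" "I \<noteq> {0\<^sub>v ?e}" by (auto simp: K_def I_def)
    hence K0: "K = {0\<^sub>v ?d}" and Ie: "I = carrier_vec ?e" using K I by auto
    have inj: "inj_cols Y" using K0 Y by (auto simp: inj_cols_def K_def)
    have "?d \<le> ?e" by (rule inj_cols_le[OF Y inj])
    have "\<exists>v\<in>carrier_vec ?d. Y *\<^sub>v v = unit_vec ?e j" if "j < ?e" for j
      using Ie that unfolding I_def by (metis (no_types, lifting) imageE unit_vec_carrier)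
    then obtain z where z: "\<And>j. j < ?e \<Longrightarrow> z j \<in> carrier_vec ?d \<and> Y *\<^sub>v z j = unit_vec ?e j" by metis
    define Z where "Z = mat ?d ?e (\<lambda>(i,j). z j $ i)"
    have Z: "Z \<in> carrier_mat ?d ?e" by (simp add: Z_def)
    have "Y * Z = 1\<^sub>m ?e"
    proof (rule eq_matI)
      fix i j assume "i < dim_row (1\<^sub>m ?e :: complex mat)" "j < dim_col (1\<^sub>m ?e :: complex mat)"
      hence i: "i < ?e" and j: "j < ?e" by auto
      have "(Y * Z) $$ (i,j) = (Y *\<^sub>v z j) $ i"
        unfolding mat_mult_sum[OF Y Z i j] mat_vec_sum[OF Y conjunct1[OF z[OF j]] i]
        using j by (intro sum.cong) (auto simp: Z_def)
      also have "\<dots> = 1\<^sub>m ?e $$ (i,j)" using z[OF j] i j by simp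
      finally show "(Y * Z) $$ (i,j) = 1\<^sub>m ?e $$ (i,j)" .
    qed (use Y Z in auto)
    hence "inj_cols Z" by (rule inj_cols_left_inverse[OF Y Z])
    hence "?e \<le> ?d" by (rule inj_cols_le[OF Z])
    with \<open>?d \<le> ?e\<close> have de: "?d = ?e" by simp
    have Y': "Y \<in> carrier_mat ?d ?d" using Y de by simp
    obtain R where "R \<in> carrier_mat ?d ?d" "Y * R = 1\<^sub>m ?d" "R * Y = 1\<^sub>m ?d"
      using inj_cols_square_inverse[OF Y' inj] by blast
    hence "invertible_mat Y" unfolding invertible_mat_def inverts_mat_def using Y' by auto
    thus ?thesis unfolding equivalent_reps_def using Y' de com by auto
  qed simp
qed

text \<open>
  An endomorphism of an irreducible representation has an eigenvalue, the field being
  \<open>\<complex>\<close>, and the eigenspace is invariant, hence everything.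
\<close>

lemma schur_scalar:
  assumes \<rho>: "irreducible_rep G \<rho>" and Y: "Y \<in> carrier_mat (rep_dim G \<rho>) (rep_dim G \<rho>)"
    and com: "\<And>g. g \<in> carrier G \<Longrightarrow> \<rho> g * Y = Y * \<rho> g"
  obtains c where "Y = c \<cdot>\<^sub>m 1\<^sub>m (rep_dim G \<rho>)"
proof -
  let ?d = "rep_dim G \<rho>"
  note \<rho>c = representationD(1)[OF irreducible_repD(1)[OF \<rho>]]
  obtain c v where v: "v \<in> carrier_vec ?d" "v \<noteq> 0\<^sub>v ?d" "Y *\<^sub>v v = c \<cdot>\<^sub>v v"
    using spectrum_non_empty[OF Y irreducible_repD(2)[OF \<rho>]] Y
    unfolding spectrum_def eigenvalue_def eigenvector_def by auto
  define E where "E = {v \<in> carrier_vec ?d. Y *\<^sub>v v = c \<cdot>\<^sub>v v}"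
  have "lin_subspace ?d E" unfolding lin_subspace_def
  proof (intro conjI ballI allI)
    have "c \<cdot>\<^sub>v 0\<^sub>v ?d = 0\<^sub>v ?d" by (rule eq_vecI) auto
    thus "0\<^sub>v ?d \<in> E" using mult_mat_vec_zero[OF Y] by (simp add: E_def)
    show "x + y \<in> E" if "x \<in> E" "y \<in> E" for x y
      using that by (simp add: E_def mult_add_distrib_mat_vec[OF Y] smult_add_distrib_vec[of _ ?d])
    show "a \<cdot>\<^sub>v x \<in> E" if "x \<in> E" for a x
      using that by (simp add: E_def mult_mat_vec[OF Y] smult_smult_assoc mult.commute)
  qed (auto simp: E_def)
  moreover have "\<rho> g *\<^sub>v v \<in> E" if "g \<in> carrier G" "v \<in> E" for g v
  proof -
    have v: "v \<in> carrier_vec ?d" "Y *\<^sub>v v = c \<cdot>\<^sub>v v" using that by (auto simp: E_def)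
    have "Y *\<^sub>v (\<rho> g *\<^sub>v v) = \<rho> g *\<^sub>v (Y *\<^sub>v v)"
      using com[OF that(1)] Y \<rho>c[OF that(1)] v by (metis assoc_mult_mat_vec)
    also have "\<dots> = c \<cdot>\<^sub>v (\<rho> g *\<^sub>v v)" using v mult_mat_vec[OF \<rho>c[OF that(1)] v(1)] by simp
    finally show ?thesis using v \<rho>c[OF that(1)] by (auto simp: E_def)
  qed
  ultimately have "E = {0\<^sub>v ?d} \<or> E = carrier_vec ?d"
    by (rule irreducible_repD(3)[OF \<rho>])
  moreover have "v \<in> E" using v by (simp add: E_def)
  ultimately have E: "E = carrier_vec ?d" using v(2) by auto
  have "Y = c \<cdot>\<^sub>m 1\<^sub>m ?d"
  proof (rule eq_matI)
    fix i j assume "i < dim_row (c \<cdot>\<^sub>m 1\<^sub>m ?d)" "j < dim_col (c \<cdot>\<^sub>m 1\<^sub>m ?d)"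
    hence i: "i < ?d" and j: "j < ?d" by auto
    have "unit_vec ?d j \<in> E" unfolding E by simp
    hence "col Y j = c \<cdot>\<^sub>v unit_vec ?d j" using mat_mult_unit_vec[OF Y j] by (simp add: E_def)
    hence "col Y j $ i = (c \<cdot>\<^sub>v unit_vec ?d j) $ i" by simp
    thus "Y $$ (i,j) = (c \<cdot>\<^sub>m 1\<^sub>m ?d) $$ (i,j)" using i j Y by simp
  qed (use Y in auto)
  thus ?thesis using that by blast
qed

section \<open>Sums over a finite group\<close>

text \<open>
  The record type is fixed to \<open>'a monoid\<close>, the type for which representations are
  defined.
\<close>

locale finite_group = group G for G :: "'a monoid" (structure) +
  assumes fin: "finite (carrier G)"

lemma (in finite_group) sum_translate:
  assumes "h \<in> carrier G"
  shows "(\<Sum>g\<in>carrier G. F (h \<otimes> g)) = (\<Sum>g\<in>carrier G. F g)"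
  by (rule sum.reindex_bij_witness[of _ "\<lambda>g. inv h \<otimes> g" "\<lambda>g. h \<otimes> g"])
    (use assms in \<open>auto simp: m_assoc[symmetric]\<close>)

lemma (in finite_group) sum_inverse:
  "(\<Sum>g\<in>carrier G. F (inv g)) = (\<Sum>g\<in>carrier G. F g)"
  by (rule sum.reindex_bij_witness[of _ "\<lambda>g. inv g" "\<lambda>g. inv g"]) auto

section \<open>Schur orthogonality\<close>

text \<open>
  The matrix \<open>\<Sum>\<^sub>g \<sigma>(g) E\<^sub>j\<^sub>k \<rho>(g\<^sup>-\<^sup>1)\<close>, where \<open>E\<^sub>j\<^sub>k\<close> is a matrix unit.
  It intertwines \<open>\<rho>\<close> with \<open>\<sigma>\<close>, so Schur's lemma
  turns its entries into orthogonality relations.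
\<close>

definition schur_avg :: "'a monoid \<Rightarrow> ('a \<Rightarrow> complex mat) \<Rightarrow> ('a \<Rightarrow> complex mat) \<Rightarrow> nat \<Rightarrow> nat \<Rightarrow> complex mat" where
  "schur_avg G \<sigma> \<rho> j k = mat (rep_dim G \<sigma>) (rep_dim G \<rho>)
     (\<lambda>(i, l). \<Sum>g\<in>carrier G. \<sigma> g $$ (i, j) * \<rho> (inv\<^bsub>G\<^esub> g) $$ (k, l))"

lemma rep_mult_entry:
  assumes "representation G \<rho>" "g \<in> carrier G" "h \<in> carrier G" "i < rep_dim G \<rho>" "j < rep_dim G \<rho>"
  shows "\<rho> (g \<otimes>\<^bsub>G\<^esub> h) $$ (i,j) = (\<Sum>l<rep_dim G \<rho>. \<rho> g $$ (i,l) * \<rho> h $$ (l,j))"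
  using mat_mult_sum[OF representationD(1)[OF assms(1,2)] representationD(1)[OF assms(1,3)] assms(4,5)]
  by (simp only: representationD(3)[OF assms(1-3)])

lemma (in finite_group) schur_avg_intertwines:
  assumes \<rho>: "representation G \<rho>" and \<sigma>: "representation G \<sigma>"
    and j: "j < rep_dim G \<sigma>" and k: "k < rep_dim G \<rho>" and h: "h \<in> carrier G"
  shows "\<sigma> h * schur_avg G \<sigma> \<rho> j k = schur_avg G \<sigma> \<rho> j k * \<rho> h"
proof (rule eq_matI)
  let ?d = "rep_dim G \<rho>" and ?e = "rep_dim G \<sigma>"
  note c = representationD(1)[OF \<rho>] representationD(1)[OF \<sigma>]
  have A: "schur_avg G \<sigma> \<rho> j k \<in> carrier_mat ?e ?d" by (simp add: schur_avg_def)
  fix i l assume "i < dim_row (schur_avg G \<sigma> \<rho> j k * \<rho> h)" "l < dim_col (schur_avg G \<sigma> \<rho> j k * \<rho> h)"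
  hence i: "i < ?e" and l: "l < ?d" using A c(1)[OF h] by auto
  have "(\<sigma> h * schur_avg G \<sigma> \<rho> j k) $$ (i,l)
      = (\<Sum>m<?e. \<Sum>g\<in>carrier G. \<sigma> h $$ (i,m) * \<sigma> g $$ (m,j) * \<rho> (inv g) $$ (k,l))"
    unfolding mat_mult_sum[OF c(2)[OF h] A i l]
    using l by (simp add: schur_avg_def sum_distrib_left mult.assoc)
  also have "\<dots> = (\<Sum>g\<in>carrier G. \<sigma> (h \<otimes> g) $$ (i,j) * \<rho> (inv g) $$ (k,l))"
    by (subst sum.swap) (simp add: rep_mult_entry[OF \<sigma> h _ i j] sum_distrib_right)
  also have "\<dots> = (\<Sum>g\<in>carrier G. \<sigma> (h \<otimes> g) $$ (i,j) * \<rho> (inv (h \<otimes> g) \<otimes> h) $$ (k,l))"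
    by (intro sum.cong) (auto simp: inv_mult_group h m_assoc)
  also have "\<dots> = (\<Sum>g\<in>carrier G. \<sigma> g $$ (i,j) * \<rho> (inv g \<otimes> h) $$ (k,l))"
    by (rule sum_translate[OF h])
  also have "\<dots> = (\<Sum>m<?d. \<Sum>g\<in>carrier G. \<sigma> g $$ (i,j) * \<rho> (inv g) $$ (k,m) * \<rho> h $$ (m,l))"
    by (subst sum.swap) (simp add: rep_mult_entry[OF \<rho> _ h k l] sum_distrib_left mult.assoc)
  also have "\<dots> = (schur_avg G \<sigma> \<rho> j k * \<rho> h) $$ (i,l)"
    unfolding mat_mult_sum[OF A c(1)[OF h] i l]
    using i by (simp add: schur_avg_def sum_distrib_right)
  finally show "(\<sigma> h * schur_avg G \<sigma> \<rho> j k) $$ (i,l) = (schur_avg G \<sigma> \<rho> j k * \<rho> h) $$ (i,l)" .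
qed (use representationD(1)[OF \<rho> h] representationD(1)[OF \<sigma> h] in \<open>auto simp: schur_avg_def\<close>)

lemma (in finite_group) schur_orthogonality_inequivalent:
  assumes \<rho>: "irreducible_rep G \<rho>" and \<sigma>: "irreducible_rep G \<sigma>" and neq: "\<not> equivalent_reps G \<rho> \<sigma>"
    and ij: "i < rep_dim G \<sigma>" "j < rep_dim G \<sigma>" and kl: "k < rep_dim G \<rho>" "l < rep_dim G \<rho>"
  shows "(\<Sum>g\<in>carrier G. \<sigma> g $$ (i,j) * \<rho> (inv g) $$ (k,l)) = 0"
proof -
  have "schur_avg G \<sigma> \<rho> j k = 0\<^sub>m (rep_dim G \<sigma>) (rep_dim G \<rho>)"
    using schur_zero_or_equivalent[OF \<rho> \<sigma>, of "schur_avg G \<sigma> \<rho> j k"] neq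
      schur_avg_intertwines[OF irreducible_repD(1)[OF \<rho>] irreducible_repD(1)[OF \<sigma>] ij(2) kl(1)]
    by (auto simp: schur_avg_def)
  from arg_cong[OF this, of "\<lambda>A. A $$ (i,l)"] show ?thesis using ij kl by (simp add: schur_avg_def)
qed

text \<open>
  The average is a scalar matrix by Schur's lemma; the scalar is found by taking the trace.
  The inverse takes the place that complex conjugation has for unitary representations.
\<close>

lemma (in finite_group) schur_orthogonality_same:
  assumes \<rho>: "irreducible_rep G \<rho>"
    and ij: "i < rep_dim G \<rho>" "j < rep_dim G \<rho>" and kl: "k < rep_dim G \<rho>" "l < rep_dim G \<rho>"
  shows "of_nat (rep_dim G \<rho>) * (\<Sum>g\<in>carrier G. \<rho> g $$ (i,j) * \<rho> (inv g) $$ (k,l))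
       = (if i = l \<and> j = k then of_nat (order G) else 0)"
proof -
  let ?d = "rep_dim G \<rho>"
  note r = irreducible_repD(1)[OF \<rho>]
  obtain c where c: "schur_avg G \<rho> \<rho> j k = c \<cdot>\<^sub>m 1\<^sub>m ?d"
    using schur_scalar[OF \<rho>, of "schur_avg G \<rho> \<rho> j k"] schur_avg_intertwines[OF r r ij(2) kl(1)]
    by (auto simp: schur_avg_def)
  have entry: "(\<Sum>g\<in>carrier G. \<rho> g $$ (i,j) * \<rho> (inv g) $$ (k,l)) = (if i = l then c else 0)"
    if "i < ?d" "l < ?d" for i l
    using arg_cong[OF c, of "\<lambda>A. A $$ (i,l)"] that by (simp add: schur_avg_def)
  have "of_nat ?d * c = (\<Sum>i<?d. \<Sum>g\<in>carrier G. \<rho> g $$ (i,j) * \<rho> (inv g) $$ (k,i))"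
    by (simp add: entry)
  also have "\<dots> = (\<Sum>g\<in>carrier G. \<rho> (inv g \<otimes> g) $$ (k,j))"
    by (subst sum.swap, intro sum.cong refl)
      (subst rep_mult_entry[OF r _ _ kl(1) ij(2)], simp_all add: mult.commute)
  also have "\<dots> = (\<Sum>g\<in>carrier G. if j = k then 1 else 0)"
    using ij kl by (intro sum.cong) (auto simp: representationD(2)[OF r])
  also have "\<dots> = (if j = k then of_nat (order G) else 0)" by (simp add: order_def)
  finally show ?thesis using entry[OF ij(1) kl(2)] by auto
qed

definition character :: "('a \<Rightarrow> complex mat) \<Rightarrow> 'a \<Rightarrow> complex" where
  "character \<rho> g = mat_trace (\<rho> g)"

lemma character_sum:
  assumes "representation G \<rho>" "g \<in> carrier G"
  shows "character \<rho> g = (\<Sum>k<rep_dim G \<rho>. \<rho> g $$ (k,k))"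
  using representationD(1)[OF assms] by (simp add: character_def mat_trace_def)

text \<open>
  In the language of the group algebra: the element
  \<open>d\<^sub>\<rho>/|G| \<Sum>\<^sub>g \<chi>\<^sub>\<rho>(g\<^sup>-\<^sup>1) g\<close> acts as the identity on \<open>\<rho>\<close> and as zero on
  every irreducible representation that is not isomorphic to \<open>\<rho>\<close>.
\<close>

lemma (in finite_group) entry_character_orthogonality:
  assumes \<rho>: "irreducible_rep G \<rho>" and \<sigma>: "irreducible_rep G \<sigma>"
    and ij: "i < rep_dim G \<sigma>" "j < rep_dim G \<sigma>"
    and eq: "\<sigma> = \<rho> \<or> \<not> equivalent_reps G \<rho> \<sigma>"
  shows "of_nat (rep_dim G \<rho>) * (\<Sum>g\<in>carrier G. character \<rho> (inv g) * \<sigma> g $$ (i,j))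
       = (if \<sigma> = \<rho> \<and> i = j then of_nat (order G) else 0)"
proof -
  have "(\<Sum>g\<in>carrier G. character \<rho> (inv g) * \<sigma> g $$ (i,j))
      = (\<Sum>k<rep_dim G \<rho>. \<Sum>g\<in>carrier G. \<sigma> g $$ (i,j) * \<rho> (inv g) $$ (k,k))"
    by (subst sum.swap)
      (simp add: character_sum[OF irreducible_repD(1)[OF \<rho>]] sum_distrib_left sum_distrib_right mult.commute)
  hence s: "of_nat (rep_dim G \<rho>) * (\<Sum>g\<in>carrier G. character \<rho> (inv g) * \<sigma> g $$ (i,j))
      = (\<Sum>k<rep_dim G \<rho>. of_nat (rep_dim G \<rho>) * (\<Sum>g\<in>carrier G. \<sigma> g $$ (i,j) * \<rho> (inv g) $$ (k,k)))"
    by (simp add: sum_distrib_left)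
  show ?thesis
  proof (cases "\<sigma> = \<rho>")
    case True
    have "(\<Sum>k<rep_dim G \<rho>. of_nat (rep_dim G \<rho>) * (\<Sum>g\<in>carrier G. \<sigma> g $$ (i,j) * \<rho> (inv g) $$ (k,k)))
        = (\<Sum>k<rep_dim G \<rho>. if k = i then (if i = j then of_nat (order G) else 0) else 0)"
      unfolding True using ij True by (intro sum.cong) (auto simp: schur_orthogonality_same[OF \<rho>])
    thus ?thesis using s ij True by simp
  next
    case False
    thus ?thesis using s eq schur_orthogonality_inequivalent[OF \<rho> \<sigma> _ ij] by simp
  qed
qed

lemma (in finite_group) character_orthogonality:
  assumes \<rho>: "irreducible_rep G \<rho>" and \<sigma>: "irreducible_rep G \<sigma>"
    and eq: "\<sigma> = \<rho> \<or> \<not> equivalent_reps G \<rho> \<sigma>"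
  shows "(\<Sum>g\<in>carrier G. character \<rho> (inv g) * character \<sigma> g) = (if \<sigma> = \<rho> then of_nat (order G) else 0)"
proof -
  have d: "(of_nat (rep_dim G \<rho>) :: complex) \<noteq> 0" using irreducible_repD(2)[OF \<rho>] by simp
  have "of_nat (rep_dim G \<rho>) * (\<Sum>g\<in>carrier G. character \<rho> (inv g) * character \<sigma> g)
     = (\<Sum>i<rep_dim G \<sigma>. of_nat (rep_dim G \<rho>) * (\<Sum>g\<in>carrier G. character \<rho> (inv g) * \<sigma> g $$ (i,i)))"
    by (subst sum_distrib_left[symmetric], subst sum.swap)
      (simp add: character_sum[OF irreducible_repD(1)[OF \<sigma>]] sum_distrib_left)
  also have "\<dots> = (\<Sum>i<rep_dim G \<sigma>. if \<sigma> = \<rho> then of_nat (order G) else 0)"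
    by (intro sum.cong) (simp_all add: entry_character_orthogonality[OF \<rho> \<sigma> _ _ eq])
  also have "\<dots> = of_nat (rep_dim G \<rho>) * (if \<sigma> = \<rho> then of_nat (order G) else 0)" by auto
  finally show ?thesis unfolding mult_left_cancel[OF d] .
qed

section \<open>Isomorphism classes\<close>

lemma equivalent_reps_refl: "equivalent_reps G \<rho> \<rho>" if "representation G \<rho>"
  unfolding equivalent_reps_def
proof (intro conjI bexI ballI)
  show "invertible_mat (1\<^sub>m (rep_dim G \<rho>) :: complex mat)"
    unfolding invertible_mat_def inverts_mat_def by (auto intro: exI[of _ "1\<^sub>m (rep_dim G \<rho>)"])
  show "1\<^sub>m (rep_dim G \<rho>) * \<rho> g = \<rho> g * 1\<^sub>m (rep_dim G \<rho>)" if "g \<in> carrier G" for g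
    using representationD(1)[OF \<open>representation G \<rho>\<close> that] by simp
qed auto

lemma equivalent_repsE:
  assumes "equivalent_reps G \<rho> \<sigma>"
  obtains T S where "rep_dim G \<sigma> = rep_dim G \<rho>"
    "T \<in> carrier_mat (rep_dim G \<rho>) (rep_dim G \<rho>)" "S \<in> carrier_mat (rep_dim G \<rho>) (rep_dim G \<rho>)"
    "T * S = 1\<^sub>m (rep_dim G \<rho>)" "S * T = 1\<^sub>m (rep_dim G \<rho>)"
    "\<And>g. g \<in> carrier G \<Longrightarrow> T * \<rho> g = \<sigma> g * T"
proof -
  obtain T where T: "rep_dim G \<sigma> = rep_dim G \<rho>" "T \<in> carrier_mat (rep_dim G \<rho>) (rep_dim G \<rho>)"
    "invertible_mat T" "\<And>g. g \<in> carrier G \<Longrightarrow> T * \<rho> g = \<sigma> g * T"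
    using assms unfolding equivalent_reps_def by auto
  obtain S where S: "T * S = 1\<^sub>m (dim_row T)" "S * T = 1\<^sub>m (dim_row S)"
    using T(3) unfolding invertible_mat_def inverts_mat_def by auto
  have "dim_row S = rep_dim G \<rho>" "dim_col S = rep_dim G \<rho>"
    using arg_cong[OF S(1), of dim_col] arg_cong[OF S(2), of dim_col] T(2) by auto
  thus ?thesis using that[of T S] S T by auto
qed

lemma equivalent_repsI:
  assumes "rep_dim G \<sigma> = rep_dim G \<rho>"
    "T \<in> carrier_mat (rep_dim G \<rho>) (rep_dim G \<rho>)" "S \<in> carrier_mat (rep_dim G \<rho>) (rep_dim G \<rho>)"
    "T * S = 1\<^sub>m (rep_dim G \<rho>)" "S * T = 1\<^sub>m (rep_dim G \<rho>)"
    "\<And>g. g \<in> carrier G \<Longrightarrow> T * \<rho> g = \<sigma> g * T"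
  shows "equivalent_reps G \<rho> \<sigma>"
  unfolding equivalent_reps_def invertible_mat_def inverts_mat_def
  using assms by (auto intro!: bexI[of _ T] exI[of _ S])

lemma equivalent_reps_sym:
  assumes "representation G \<rho>" "representation G \<sigma>" "equivalent_reps G \<rho> \<sigma>"
  shows "equivalent_reps G \<sigma> \<rho>"
  using assms(3)
proof (rule equivalent_repsE)
  let ?d = "rep_dim G \<rho>"
  fix T S assume d: "rep_dim G \<sigma> = ?d" and T: "T \<in> carrier_mat ?d ?d" and S: "S \<in> carrier_mat ?d ?d"
    and TS: "T * S = 1\<^sub>m ?d" and ST: "S * T = 1\<^sub>m ?d"
    and com: "\<And>g. g \<in> carrier G \<Longrightarrow> T * \<rho> g = \<sigma> g * T"
  have "S * \<sigma> g = \<rho> g * S" if g: "g \<in> carrier G" for g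
  proof -
    note c = representationD(1)[OF assms(1) g] representationD(1)[OF assms(2) g, unfolded d]
    have "S * \<sigma> g = S * \<sigma> g * (T * S)" using TS S c by simp
    also have "\<dots> = S * (\<sigma> g * T) * S" using S T c by (simp add: assoc_mult_mat[of _ ?d ?d _ ?d _ ?d])
    also have "\<dots> = (S * T) * \<rho> g * S"
      unfolding com[OF g, symmetric] using S T c by (simp add: assoc_mult_mat[of _ ?d ?d _ ?d _ ?d])
    also have "\<dots> = \<rho> g * S" using ST c by simp
    finally show ?thesis .
  qed
  thus ?thesis using equivalent_repsI[of G \<rho> \<sigma> S T] d T S TS ST by simp
qed

lemma equivalent_reps_trans:
  assumes "representation G \<rho>" "representation G \<sigma>" "representation G \<pi>"
    and "equivalent_reps G \<rho> \<sigma>" "equivalent_reps G \<sigma> \<pi>"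
  shows "equivalent_reps G \<rho> \<pi>"
  using assms(4)
proof (rule equivalent_repsE)
  let ?d = "rep_dim G \<rho>"
  fix T S assume d: "rep_dim G \<sigma> = ?d" and T: "T \<in> carrier_mat ?d ?d" and S: "S \<in> carrier_mat ?d ?d"
    and TS: "T * S = 1\<^sub>m ?d" and ST: "S * T = 1\<^sub>m ?d"
    and com: "\<And>g. g \<in> carrier G \<Longrightarrow> T * \<rho> g = \<sigma> g * T"
  note ass = assoc_mult_mat[of _ ?d ?d _ ?d _ ?d]
  show ?thesis using assms(5)
  proof (rule equivalent_repsE, unfold d)
    fix T' S' assume d': "rep_dim G \<pi> = ?d" and T': "T' \<in> carrier_mat ?d ?d" and S': "S' \<in> carrier_mat ?d ?d"
      and TS': "T' * S' = 1\<^sub>m ?d" and ST': "S' * T' = 1\<^sub>m ?d"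
      and com': "\<And>g. g \<in> carrier G \<Longrightarrow> T' * \<sigma> g = \<pi> g * T'"
    show ?thesis
    proof (rule equivalent_repsI[where T = "T' * T" and S = "S * S'"])
      have "(T' * T) * (S * S') = T' * (T * S) * S'" using T S T' S' by (simp add: ass)
      thus "(T' * T) * (S * S') = 1\<^sub>m ?d" using TS TS' T' by simp
      have "(S * S') * (T' * T) = S * (S' * T') * T" using T S T' S' by (simp add: ass)
      thus "(S * S') * (T' * T) = 1\<^sub>m ?d" using ST ST' S by simp
      show "(T' * T) * \<rho> g = \<pi> g * (T' * T)" if g: "g \<in> carrier G" for g
      proof -
        note c = representationD(1)[OF assms(1) g] representationD(1)[OF assms(2) g, unfolded d]
          representationD(1)[OF assms(3) g, unfolded d']
        have "(T' * T) * \<rho> g = T' * (\<sigma> g * T)" using T T' c com[OF g] by (simp add: ass)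
        also have "\<dots> = (T' * \<sigma> g) * T" using T T' c by (simp add: ass)
        also have "\<dots> = \<pi> g * (T' * T)" using T T' c com'[OF g] by (simp add: ass)
        finally show ?thesis .
      qed
    qed (use d' T S T' S' in auto)
  qed
qed

lemma equiv_equivalent_reps:
  "equiv {\<rho>. irreducible_rep G \<rho>}
     {(\<rho>, \<sigma>). irreducible_rep G \<rho> \<and> irreducible_rep G \<sigma> \<and> equivalent_reps G \<rho> \<sigma>}"
  by (rule equivI)
    (auto simp: refl_on_def sym_def trans_def dest: irreducible_repD(1)
      intro: equivalent_reps_refl equivalent_reps_sym equivalent_reps_trans)

lemma rep_of_mem: assumes "C \<in> irreps G" shows "rep_of C \<in> C"
  using in_quotient_imp_non_empty[OF equiv_equivalent_reps assms[unfolded irreps_def]]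
  unfolding rep_of_def by (metis ex_in_conv someI_ex)

lemma irreducible_rep_of: assumes "C \<in> irreps G" shows "irreducible_rep G (rep_of C)"
  using in_quotient_imp_subset[OF equiv_equivalent_reps assms[unfolded irreps_def]] rep_of_mem[OF assms]
  by auto

lemma rep_of_inequivalent:
  assumes "C \<in> irreps G" "D \<in> irreps G" "C \<noteq> D"
  shows "\<not> equivalent_reps G (rep_of C) (rep_of D)"
  using quotient_eqI[OF equiv_equivalent_reps assms(1,2)[unfolded irreps_def]
      rep_of_mem[OF assms(1)] rep_of_mem[OF assms(2)]]
    irreducible_rep_of assms by auto

lemma rep_of_eq_iff:
  assumes "C \<in> irreps G" "D \<in> irreps G"
  shows "rep_of C = rep_of D \<longleftrightarrow> C = D"
proof
  assume "rep_of C = rep_of D"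
  hence "equivalent_reps G (rep_of C) (rep_of D)"
    using equivalent_reps_refl[OF irreducible_repD(1)[OF irreducible_rep_of[OF assms(1)]]] by simp
  thus "C = D" using rep_of_inequivalent[OF assms] by blast
qed simp

lemma ex_equivalent_rep_of:
  assumes "irreducible_rep G \<sigma>"
  obtains C where "C \<in> irreps G" "equivalent_reps G \<sigma> (rep_of C)"
proof -
  let ?r = "{(\<rho>, \<sigma>). irreducible_rep G \<rho> \<and> irreducible_rep G \<sigma> \<and> equivalent_reps G \<rho> \<sigma>}"
  have C: "?r `` {\<sigma>} \<in> irreps G" unfolding irreps_def using assms by (intro quotientI) auto
  show ?thesis using that[OF C] rep_of_mem[OF C] by auto
qed

text \<open>
  Characters of distinct classes are orthogonal, hence linearly independent functions
  on \<open>G\<close>, so there are at most \<open>|G|\<close> of them. Without finiteness a sum over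
  \<open>irreps G\<close> would be zero by convention.
\<close>

lemma (in finite_group) finite_irreps:
  shows "finite (irreps G)"
proof (rule ccontr)
  let ?N = "order G"
  assume "infinite (irreps G)"
  then obtain S where S: "S \<subseteq> irreps G" "finite S" "card S = Suc ?N"
    using infinite_arbitrarily_large by blast
  obtain c where c: "bij_betw c {0..<Suc ?N} S" using ex_bij_betw_nat_finite[OF S(2)] S(3) by auto
  obtain e where e: "bij_betw e {0..<?N} (carrier G)"
    using ex_bij_betw_nat_finite[OF fin] by (auto simp: order_def)
  have cS: "c k \<in> irreps G" if "k < Suc ?N" for k
    using bij_betw_apply[OF c, of k] that S(1) by auto
  define A where "A = mat ?N (Suc ?N) (\<lambda>(i,k). character (rep_of (c k)) (e i))"
  have A: "A \<in> carrier_mat ?N (Suc ?N)" by (simp add: A_def)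
  have "inj_cols A" unfolding inj_cols_def
  proof (intro ballI impI)
    fix v assume "v \<in> carrier_vec (dim_col A)" "A *\<^sub>v v = 0\<^sub>v (dim_row A)"
    hence v: "v \<in> carrier_vec (Suc ?N)" and z: "A *\<^sub>v v = 0\<^sub>v ?N" using A by auto
    have z': "(\<Sum>k<Suc ?N. character (rep_of (c k)) g * v $ k) = 0" if g: "g \<in> carrier G" for g
    proof -
      have "g \<in> e ` {0..<?N}" using e g by (simp add: bij_betw_def)
      then obtain i where i: "i < ?N" "g = e i" by auto
      have "(A *\<^sub>v v) $ i = 0" using z i by simp
      thus ?thesis using mat_vec_sum[OF A v i(1)] i by (simp add: A_def)
    qed
    have "v $ l = 0" if l: "l < Suc ?N" for l
    proof -
      have "0 = (\<Sum>g\<in>carrier G. character (rep_of (c l)) (inv g) * (\<Sum>k<Suc ?N. character (rep_of (c k)) g * v $ k))"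
        using z' by simp
      also have "\<dots> = (\<Sum>k<Suc ?N. v $ k * (\<Sum>g\<in>carrier G. character (rep_of (c l)) (inv g) * character (rep_of (c k)) g))"
        by (simp add: sum_distrib_left sum.swap[of _ _ "carrier G"] mult_ac del: sum.lessThan_Suc)
      also have "\<dots> = (\<Sum>k<Suc ?N. if k = l then v $ k * of_nat ?N else 0)"
      proof (intro sum.cong refl)
        fix k assume k: "k \<in> {..<Suc ?N}"
        have kl: "c l = c k \<longleftrightarrow> k = l" using c k l by (auto simp: bij_betw_def inj_on_def)
        show "v $ k * (\<Sum>g\<in>carrier G. character (rep_of (c l)) (inv g) * character (rep_of (c k)) g)
            = (if k = l then v $ k * of_nat ?N else 0)"
          using character_orthogonality[OF irreducible_rep_of irreducible_rep_of, OF cS[OF l] cS[of k]]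
            rep_of_inequivalent[OF cS[OF l] cS[of k]] rep_of_eq_iff[OF cS[of k] cS[OF l]] kl k by auto
      qed
      also have "\<dots> = v $ l * of_nat ?N" using l by simp
      finally show "v $ l = 0" using fin order_gt_0_iff_finite by auto
    qed
    thus "v = 0\<^sub>v (dim_col A)" using v A by (intro eq_vecI) auto
  qed
  from inj_cols_le[OF A this] show False by simp
qed

section \<open>Irreducible subrepresentations\<close>

lemma restrict_to_range:
  fixes A :: "'a :: field mat"
  assumes A: "A \<in> carrier_mat n n" and Q: "Q \<in> carrier_mat n m"
    and inv: "\<And>v. v \<in> carrier_vec m \<Longrightarrow> A *\<^sub>v (Q *\<^sub>v v) \<in> (\<lambda>v. Q *\<^sub>v v) ` carrier_vec m"
  obtains S where "S \<in> carrier_mat m m" "A * Q = Q * S"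
proof -
  have "\<exists>s\<in>carrier_vec m. A *\<^sub>v col Q j = Q *\<^sub>v s" if "j < m" for j
    using inv[of "unit_vec m j"] mat_mult_unit_vec[OF Q that] by auto
  then obtain s where s: "\<And>j. j < m \<Longrightarrow> s j \<in> carrier_vec m \<and> A *\<^sub>v col Q j = Q *\<^sub>v s j" by metis
  define S where "S = mat m m (\<lambda>(i,j). s j $ i)"
  have S: "S \<in> carrier_mat m m" by (simp add: S_def)
  have "A * Q = Q * S"
  proof (rule eq_matI)
    fix i j assume "i < dim_row (Q * S)" "j < dim_col (Q * S)"
    hence i: "i < n" and j: "j < m" using Q S by auto
    have "(A * Q) $$ (i,j) = (A *\<^sub>v col Q j) $ i" using A Q i j by simp
    also have "\<dots> = (Q *\<^sub>v s j) $ i" using s[OF j] by simp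
    also have "\<dots> = (Q * S) $$ (i,j)"
      unfolding mat_mult_sum[OF Q S i j] mat_vec_sum[OF Q conjunct1[OF s[OF j]] i]
      using j by (intro sum.cong) (auto simp: S_def)
    finally show "(A * Q) $$ (i,j) = (Q * S) $$ (i,j)" .
  qed (use A Q S in auto)
  thus ?thesis using that S by blast
qed

text \<open>
  Among all subrepresentations realised by an injective matrix with range inside
  \<open>W\<close>, one of least positive dimension is irreducible: a nonzero proper
  invariant subspace of it would give a smaller one.
\<close>

lemma (in finite_group) ex_irreducible_subrep:
  assumes R: "representation G R" and n: "rep_dim G R = n"
    and W: "lin_subspace n W" "W \<noteq> {0\<^sub>v n}"
    and inv: "\<And>g v. g \<in> carrier G \<Longrightarrow> v \<in> W \<Longrightarrow> R g *\<^sub>v v \<in> W"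
  obtains P \<sigma> where "irreducible_rep G \<sigma>" "P \<in> carrier_mat n (rep_dim G \<sigma>)" "inj_cols P"
    "\<And>v. v \<in> carrier_vec (rep_dim G \<sigma>) \<Longrightarrow> P *\<^sub>v v \<in> W"
    "\<And>g. g \<in> carrier G \<Longrightarrow> R g * P = P * \<sigma> g"
proof -
  note Rc = representationD(1)[OF R, unfolded n]
  define good where "good d \<longleftrightarrow> d > 0 \<and> (\<exists>P\<in>carrier_mat n d. \<exists>\<sigma>. inj_cols P \<and> (\<forall>v\<in>carrier_vec d. P *\<^sub>v v \<in> W) \<and>
      (\<forall>g\<in>carrier G. \<sigma> g \<in> carrier_mat d d \<and> R g * P = P * \<sigma> g))" for d
  obtain m Q where Q: "Q \<in> carrier_mat n m" "inj_cols Q" "W = (\<lambda>v. Q *\<^sub>v v) ` carrier_vec m"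
    using lin_subspace_column_basis[OF W(1)] by metis
  have "\<exists>S. S \<in> carrier_mat m m \<and> R g * Q = Q * S" if g: "g \<in> carrier G" for g
    by (rule restrict_to_range[OF Rc[OF g] Q(1)]) (use inv[OF g] Q(3) in blast)+
  then obtain s where s: "\<And>g. g \<in> carrier G \<Longrightarrow> s g \<in> carrier_mat m m \<and> R g * Q = Q * s g" by metis
  have m0: "m > 0"
  proof (rule ccontr)
    assume "\<not> m > 0"
    hence m: "m = 0" by simp
    have "Q *\<^sub>v v = 0\<^sub>v n" if "v \<in> carrier_vec m" for v
      using Q(1) that m by (intro eq_vecI) (auto simp: scalar_prod_def)
    hence "W \<subseteq> {0\<^sub>v n}" using Q(3) by auto
    thus False using W by (auto simp: lin_subspace_def)
  qed
  have "good m" unfolding good_def using m0 Q s by blast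
  then obtain d where d: "good d" and mn: "\<And>k. good k \<Longrightarrow> d \<le> k"
    using LeastI[of good m] Least_le[of good] by metis
  then obtain P \<sigma> where d0: "d > 0" and P: "P \<in> carrier_mat n d" "inj_cols P" "\<And>v. v \<in> carrier_vec d \<Longrightarrow> P *\<^sub>v v \<in> W"
    and \<sigma>: "\<And>g. g \<in> carrier G \<Longrightarrow> \<sigma> g \<in> carrier_mat d d" "\<And>g. g \<in> carrier G \<Longrightarrow> R g * P = P * \<sigma> g"
    unfolding good_def by blast
  have dim: "rep_dim G \<sigma> = d" using \<sigma>(1)[OF one_closed] by (simp add: rep_dim_def)
  have "\<sigma> \<one> = 1\<^sub>m d"
    by (rule inj_cols_cancel[OF P(1,2) \<sigma>(1)[OF one_closed] one_carrier_mat])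
      (use \<sigma>(2)[OF one_closed] representationD(2)[OF R] n P in simp)
  moreover have "\<sigma> (g \<otimes> h) = \<sigma> g * \<sigma> h" if g: "g \<in> carrier G" and h: "h \<in> carrier G" for g h
  proof (rule inj_cols_cancel[OF P(1,2) \<sigma>(1)[OF m_closed[OF g h]] mult_carrier_mat[OF \<sigma>(1)[OF g] \<sigma>(1)[OF h]]])
    have "P * \<sigma> (g \<otimes> h) = R g * R h * P" using \<sigma>(2)[OF m_closed[OF g h]] representationD(3)[OF R g h] by simp
    also have "\<dots> = R g * (P * \<sigma> h)"
      using assoc_mult_mat[OF Rc[OF g] Rc[OF h] P(1)] \<sigma>(2)[OF h] by simp
    also have "\<dots> = (P * \<sigma> g) * \<sigma> h"
      using assoc_mult_mat[OF Rc[OF g] P(1) \<sigma>(1)[OF h]] \<sigma>(2)[OF g] by simp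
    also have "\<dots> = P * (\<sigma> g * \<sigma> h)" using assoc_mult_mat[OF P(1) \<sigma>(1)[OF g] \<sigma>(1)[OF h]] .
    finally show "P * \<sigma> (g \<otimes> h) = P * (\<sigma> g * \<sigma> h)" .
  qed
  ultimately have rep: "representation G \<sigma>" unfolding representation_def dim using \<sigma>(1) by auto
  have "X = {0\<^sub>v d} \<or> X = carrier_vec d"
    if X: "lin_subspace d X" and Xinv: "\<forall>g\<in>carrier G. \<forall>v\<in>X. \<sigma> g *\<^sub>v v \<in> X" for X
  proof -
    obtain k B where k: "k \<le> d" and B: "B \<in> carrier_mat d k" "inj_cols B" "X = (\<lambda>v. B *\<^sub>v v) ` carrier_vec k"
      and full: "k = d \<Longrightarrow> X = carrier_vec d"
      using lin_subspace_column_basis[OF X] by metis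
    show ?thesis
    proof (cases "k = 0")
      case True
      have "B *\<^sub>v v = 0\<^sub>v d" if "v \<in> carrier_vec k" for v
        using B(1) that True by (intro eq_vecI) (auto simp: scalar_prod_def)
      hence "X \<subseteq> {0\<^sub>v d}" using B(3) by auto
      thus ?thesis using X by (auto simp: lin_subspace_def)
    next
      case False
      have "\<exists>S. S \<in> carrier_mat k k \<and> \<sigma> g * B = B * S" if g: "g \<in> carrier G" for g
        by (rule restrict_to_range[OF \<sigma>(1)[OF g] B(1)]) (use Xinv g B(3) in blast)+
      then obtain s where s: "\<And>g. g \<in> carrier G \<Longrightarrow> s g \<in> carrier_mat k k \<and> \<sigma> g * B = B * s g" by metis
      have "good k" unfolding good_def
      proof (intro conjI bexI exI ballI)
        show "k > 0" using False by simp
        show PB: "P * B \<in> carrier_mat n k" using P B by simp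
        show "inj_cols (P * B)" by (rule inj_cols_mult[OF P(1,2) B(1,2)])
        show "P * B *\<^sub>v v \<in> W" if "v \<in> carrier_vec k" for v
          using P(1) B(1) that P(3)[of "B *\<^sub>v v"] by simp
        show "s g \<in> carrier_mat k k" if "g \<in> carrier G" for g using s[OF that] by simp
        show "R g * (P * B) = P * B * s g" if g: "g \<in> carrier G" for g
        proof -
          have "R g * (P * B) = (P * \<sigma> g) * B" using assoc_mult_mat[OF Rc[OF g] P(1) B(1)] \<sigma>(2)[OF g] by simp
          also have "\<dots> = P * (B * s g)" using assoc_mult_mat[OF P(1) \<sigma>(1)[OF g] B(1)] s[OF g] by simp
          also have "\<dots> = P * B * s g" using assoc_mult_mat[OF P(1) B(1) conjunct1[OF s[OF g]]] by simp
          finally show ?thesis .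
        qed
      qed
      hence "k = d" using mn[of k] k by simp
      thus ?thesis using full by simp
    qed
  qed
  hence "irreducible_rep G \<sigma>" unfolding irreducible_rep_def subspace_module_vec_iff dim using rep d0 by auto
  thus ?thesis using that P \<sigma> dim by metis
qed

section \<open>The Fourier transform is injective\<close>

text \<open>
  Complex-valued functions are admitted, whereas \<open>fourier\<close> takes real-valued ones: the proof of
  injectivity evaluates the transform of complex conjugates of matrix coefficients.
\<close>

definition fourier_vanishes :: "'a monoid \<Rightarrow> ('a \<Rightarrow> complex) \<Rightarrow> ('a \<Rightarrow> complex mat) \<Rightarrow> bool" where
  "fourier_vanishes G f \<sigma> \<longleftrightarrow> (\<forall>i<rep_dim G \<sigma>. \<forall>j<rep_dim G \<sigma>. (\<Sum>g\<in>carrier G. f g * \<sigma> g $$ (i,j)) = 0)"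

text \<open>
  The functions \<open>v\<close> for which \<open>g \<mapsto> cnj (v (g\<^sup>-\<^sup>1))\<close> has vanishing Fourier transform form
  a subspace \<open>W\<close> invariant under the regular representation. If it were nonzero, it would
  contain an irreducible subrepresentation \<open>\<sigma>\<close>. A basis function \<open>u\<close> of it satisfies
  \<open>u(g\<^sup>-\<^sup>1) = \<Sum>\<^sub>l c\<^sub>l \<sigma>(g)\<^sub>l\<^sub>0\<close>, because both sides are the value at the identity of the
  translate of \<open>u\<close> by \<open>g\<close>. Since \<open>u\<close> also lies in \<open>W\<close>, the function
  \<open>g \<mapsto> cnj (u (g\<^sup>-\<^sup>1))\<close> is killed by \<open>\<sigma>\<close>, so that
  \<open>\<Sum>\<^sub>g cnj (u (g\<^sup>-\<^sup>1)) u (g\<^sup>-\<^sup>1) = 0\<close> and \<open>u = 0\<close>, a contradiction.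
\<close>

lemma (in finite_group) fourier_injective:
  assumes kill: "\<And>\<sigma>. irreducible_rep G \<sigma> \<Longrightarrow> fourier_vanishes G f \<sigma>"
    and x: "x \<in> carrier G"
  shows "f x = 0"
proof -
  let ?N = "order G"
  obtain e where e: "bij_betw e {0..<?N} (carrier G)"
    using ex_bij_betw_nat_finite[OF fin] by (auto simp: order_def)
  define idx where "idx = inv_into {0..<?N} e"
  have idx: "idx g < ?N" "e (idx g) = g" if "g \<in> carrier G" for g
    using e that inv_into_into[of g e "{0..<?N}"] f_inv_into_f[of g e "{0..<?N}"]
    by (auto simp: idx_def bij_betw_def)
  have ec: "e i \<in> carrier G" "idx (e i) = i" if "i < ?N" for i
    using e that by (auto simp: idx_def bij_betw_def)
  \<comment> \<open>The left regular representation, \<open>(R h v)(x) = v (h\<^sup>-\<^sup>1 x)\<close>, with functions on the group encoded as vectors.\<close>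
  define R where "R h = mat ?N ?N (\<lambda>(i,j). if j = idx (inv h \<otimes> e i) then 1 else 0 :: complex)" for h
  have Rc: "R h \<in> carrier_mat ?N ?N" for h by (simp add: R_def)
  have dimR: "rep_dim G R = ?N" by (simp add: rep_dim_def R_def)
  have R1: "R \<one> = 1\<^sub>m ?N" by (rule eq_matI) (auto simp: R_def ec)
  have Rm: "R (g \<otimes> h) = R g * R h" if g: "g \<in> carrier G" and h: "h \<in> carrier G" for g h
  proof (rule eq_matI)
    fix i j assume "i < dim_row (R g * R h)" "j < dim_col (R g * R h)"
    hence i: "i < ?N" and j: "j < ?N" using Rc[of g] Rc[of h] by auto
    have "(R g * R h) $$ (i,j) = (\<Sum>l<?N. if l = idx (inv g \<otimes> e i) then R h $$ (l,j) else 0)"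
      unfolding mat_mult_sum[OF Rc Rc i j] using i by (intro sum.cong refl) (simp add: R_def[of g])
    also have "\<dots> = R h $$ (idx (inv g \<otimes> e i), j)" using idx g ec[OF i] by simp
    also have "\<dots> = R (g \<otimes> h) $$ (i,j)"
      using i j g h idx ec[OF i] by (simp add: R_def inv_mult_group m_assoc)
    finally show "R (g \<otimes> h) $$ (i,j) = (R g * R h) $$ (i,j)" by simp
  qed (auto simp: R_def)
  have rep: "representation G R" unfolding representation_def dimR using Rc R1 Rm by auto
  have Rv: "(R h *\<^sub>v v) $ idx g = v $ idx (inv h \<otimes> g)"
    if h: "h \<in> carrier G" and g: "g \<in> carrier G" and v: "v \<in> carrier_vec ?N" for h g v
  proof -
    have "(R h *\<^sub>v v) $ idx g = (\<Sum>j<?N. if j = idx (inv h \<otimes> g) then v $ j else 0)"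
      unfolding mat_vec_sum[OF Rc v idx(1)[OF g]]
      using idx[OF g] by (intro sum.cong refl) (simp add: R_def)
    thus ?thesis using idx g h by simp
  qed
  define W where "W = {v \<in> carrier_vec ?N. \<forall>\<sigma>. irreducible_rep G \<sigma> \<longrightarrow> fourier_vanishes G (\<lambda>g. cnj (v $ idx (inv g))) \<sigma>}"
  have "W = {0\<^sub>v ?N}"
  proof (rule ccontr)
    assume W0: "W \<noteq> {0\<^sub>v ?N}"
    have W: "lin_subspace ?N W" unfolding lin_subspace_def
    proof (intro conjI ballI allI)
      show "0\<^sub>v ?N \<in> W" by (simp add: W_def fourier_vanishes_def idx)
      show "v + w \<in> W" if "v \<in> W" "w \<in> W" for v w
        using that by (auto simp: W_def fourier_vanishes_def idx sum.distrib distrib_right)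
      show "c \<cdot>\<^sub>v v \<in> W" if "v \<in> W" for c v
        using that by (auto simp: W_def fourier_vanishes_def idx mult.assoc sum_distrib_left[symmetric])
    qed (auto simp: W_def)
    have inv: "R h *\<^sub>v v \<in> W" if h: "h \<in> carrier G" and v: "v \<in> W" for h v
    proof -
      have vc: "v \<in> carrier_vec ?N" using v by (simp add: W_def)
      have "fourier_vanishes G (\<lambda>g. cnj ((R h *\<^sub>v v) $ idx (inv g))) \<sigma>" if \<sigma>: "irreducible_rep G \<sigma>" for \<sigma>
        unfolding fourier_vanishes_def
      proof (intro allI impI)
        note r = irreducible_repD(1)[OF \<sigma>]
        fix i j assume i: "i < rep_dim G \<sigma>" and j: "j < rep_dim G \<sigma>"
        have kv: "(\<Sum>g\<in>carrier G. cnj (v $ idx g) * \<sigma> (inv g) $$ (i,l)) = 0" if "l < rep_dim G \<sigma>" for l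
        proof -
          have "(\<Sum>g\<in>carrier G. cnj (v $ idx (inv g)) * \<sigma> g $$ (i,l)) = 0"
            using v \<sigma> i that by (simp add: W_def fourier_vanishes_def)
          thus ?thesis by (subst (asm) sum_inverse[symmetric]) simp
        qed
        have "(\<Sum>g\<in>carrier G. cnj ((R h *\<^sub>v v) $ idx (inv g)) * \<sigma> g $$ (i,j))
            = (\<Sum>g\<in>carrier G. cnj (v $ idx (inv h \<otimes> g)) * \<sigma> (inv g) $$ (i,j))"
          by (subst sum_inverse[symmetric]) (simp add: Rv[OF h _ vc])
        also have "\<dots> = (\<Sum>g\<in>carrier G. cnj (v $ idx (inv h \<otimes> (h \<otimes> g))) * \<sigma> (inv (h \<otimes> g)) $$ (i,j))"
          by (rule sum_translate[OF h, symmetric])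
        also have "\<dots> = (\<Sum>g\<in>carrier G. cnj (v $ idx g) * \<sigma> (inv g \<otimes> inv h) $$ (i,j))"
          using h by (intro sum.cong) (auto simp: m_assoc[symmetric] inv_mult_group)
        also have "\<dots> = (\<Sum>l<rep_dim G \<sigma>. (\<Sum>g\<in>carrier G. cnj (v $ idx g) * \<sigma> (inv g) $$ (i,l)) * \<sigma> (inv h) $$ (l,j))"
          using h by (simp add: rep_mult_entry[OF r _ _ i j] sum_distrib_left sum_distrib_right mult.assoc sum.swap[of _ _ "carrier G"])
        also have "\<dots> = 0" by (simp add: kv)
        finally show "(\<Sum>g\<in>carrier G. cnj ((R h *\<^sub>v v) $ idx (inv g)) * \<sigma> g $$ (i,j)) = 0" .
      qed
      thus ?thesis using vc Rc[of h] by (auto simp: W_def)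
    qed
    obtain P \<sigma> where \<sigma>: "irreducible_rep G \<sigma>" and P: "P \<in> carrier_mat ?N (rep_dim G \<sigma>)" "inj_cols P"
      and PW: "\<And>v. v \<in> carrier_vec (rep_dim G \<sigma>) \<Longrightarrow> P *\<^sub>v v \<in> W"
      and RP: "\<And>g. g \<in> carrier G \<Longrightarrow> R g * P = P * \<sigma> g"
      using ex_irreducible_subrep[OF rep dimR W W0 inv] by metis
    let ?d = "rep_dim G \<sigma>"
    have d: "0 < ?d" by (rule irreducible_repD(2)[OF \<sigma>])
    \<comment> \<open>The first column of \<open>P\<close>, read as a function on the group.\<close>
    define u where "u g = P $$ (idx g, 0)" for g
    have u_eq: "u (inv g) = (\<Sum>l<?d. P $$ (idx \<one>, l) * \<sigma> g $$ (l,0))"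
      if g: "g \<in> carrier G" for g
    proof -
      have "P $$ (idx (inv g), 0) = (R g *\<^sub>v col P 0) $ idx \<one>"
        using Rv[OF g one_closed col_carrier_vec[OF d P(1)]] P d g idx by (simp del: index_mult_mat_vec)
      also have "\<dots> = (R g * P) $$ (idx \<one>, 0)" using P Rc[of g] idx d by simp
      also have "\<dots> = (P * \<sigma> g) $$ (idx \<one>, 0)" by (simp only: RP[OF g])
      also have "\<dots> = (\<Sum>l<?d. P $$ (idx \<one>, l) * \<sigma> g $$ (l,0))"
        by (rule mat_mult_sum[OF P(1) representationD(1)[OF irreducible_repD(1)[OF \<sigma>] g]]) (use idx d in auto)
      finally show ?thesis by (simp add: u_def)
    qed
    have "col P 0 \<in> W" using PW[of "unit_vec ?d 0"] mat_mult_unit_vec[OF P(1) d] by simp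
    hence ku: "(\<Sum>g\<in>carrier G. cnj (u (inv g)) * \<sigma> g $$ (l,0)) = 0" if "l < ?d" for l
      using \<sigma> that d P idx by (simp add: W_def fourier_vanishes_def u_def)
    have "(\<Sum>g\<in>carrier G. cnj (u (inv g)) * u (inv g))
        = (\<Sum>g\<in>carrier G. \<Sum>l<?d. P $$ (idx \<one>, l) * (cnj (u (inv g)) * \<sigma> g $$ (l,0)))"
      by (intro sum.cong refl, subst (2) u_eq, assumption)
        (simp only: sum_distrib_left mult.left_commute[of "cnj _"])
    also have "\<dots> = (\<Sum>l<?d. P $$ (idx \<one>, l) * (\<Sum>g\<in>carrier G. cnj (u (inv g)) * \<sigma> g $$ (l,0)))"
      by (subst sum.swap) (simp add: sum_distrib_left)
    also have "\<dots> = 0" by (simp add: ku)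
    finally have "(\<Sum>g\<in>carrier G. cnj (u g) * u g) = 0" by (subst (asm) sum_inverse)
    hence "complex_of_real (\<Sum>g\<in>carrier G. (cmod (u g))\<^sup>2) = 0"
      by (simp add: complex_norm_square[symmetric] mult.commute[of "cnj _"])
    hence "(\<Sum>g\<in>carrier G. (cmod (u g))\<^sup>2) = 0" using of_real_eq_0_iff by blast
    hence u0: "u g = 0" if "g \<in> carrier G" for g
      using that fin by (subst (asm) sum_nonneg_eq_0_iff) auto
    have "P *\<^sub>v unit_vec ?d 0 = 0\<^sub>v ?N"
      unfolding mat_mult_unit_vec[OF P(1) d] using P d u0[OF ec(1)] ec(2) by (intro eq_vecI) (auto simp: u_def)
    hence "unit_vec ?d 0 = (0\<^sub>v ?d :: complex vec)" by (rule inj_colsD[OF P(2,1), rotated]) simp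
    thus False using d by (metis unit_vec_nonzero)
  qed
  moreover have "vec ?N (\<lambda>i. cnj (f (inv (e i)))) \<in> W"
  proof -
    have "fourier_vanishes G (\<lambda>g. cnj (vec ?N (\<lambda>i. cnj (f (inv (e i)))) $ idx (inv g))) \<sigma>" if "irreducible_rep G \<sigma>" for \<sigma>
      using kill[OF that] by (simp add: fourier_vanishes_def idx)
    thus ?thesis by (simp add: W_def)
  qed
  ultimately have "vec ?N (\<lambda>i. cnj (f (inv (e i)))) = 0\<^sub>v ?N" by auto
  from arg_cong[OF this, of "\<lambda>v. v $ idx (inv x)"] show ?thesis using x idx by simp
qed

section \<open>The regular character and Plancherel's formula\<close>

lemma fourier_vanishes_equivalent:
  assumes \<rho>: "representation G \<rho>" and \<sigma>: "representation G \<sigma>" and eq: "equivalent_reps G \<sigma> \<rho>"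
    and k: "fourier_vanishes G f \<rho>"
  shows "fourier_vanishes G f \<sigma>"
proof -
  let ?d = "rep_dim G \<sigma>"
  obtain T S where d: "rep_dim G \<rho> = ?d" and T: "T \<in> carrier_mat ?d ?d" and S: "S \<in> carrier_mat ?d ?d"
    and ST: "S * T = 1\<^sub>m ?d" and com: "\<And>g. g \<in> carrier G \<Longrightarrow> T * \<sigma> g = \<rho> g * T"
    using equivalent_repsE[OF eq] by metis
  have sig: "\<sigma> g $$ (i,j) = (\<Sum>b<?d. \<Sum>a<?d. S $$ (i,a) * \<rho> g $$ (a,b) * T $$ (b,j))"
    if g: "g \<in> carrier G" and i: "i < ?d" and j: "j < ?d" for g i j
  proof -
    note c = representationD(1)[OF \<sigma> g] representationD(1)[OF \<rho> g, unfolded d]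
    have "\<sigma> g = S * T * \<sigma> g" using ST c by simp
    also have "\<dots> = S * \<rho> g * T" using com[OF g] S T c by (simp add: assoc_mult_mat[of _ ?d ?d _ ?d _ ?d])
    finally have "\<sigma> g $$ (i,j) = (S * \<rho> g * T) $$ (i,j)" by simp
    also have "\<dots> = (\<Sum>b<?d. (\<Sum>a<?d. S $$ (i,a) * \<rho> g $$ (a,b)) * T $$ (b,j))"
      using mat_mult_sum[OF mult_carrier_mat[OF S c(2)] T i j] mat_mult_sum[OF S c(2) i] by simp
    finally show ?thesis by (simp add: sum_distrib_right)
  qed
  have "(\<Sum>g\<in>carrier G. f g * \<sigma> g $$ (i,j)) = 0" if i: "i < ?d" and j: "j < ?d" for i j
  proof -
    have "(\<Sum>g\<in>carrier G. f g * \<sigma> g $$ (i,j))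
        = (\<Sum>g\<in>carrier G. \<Sum>b<?d. \<Sum>a<?d. S $$ (i,a) * (f g * \<rho> g $$ (a,b)) * T $$ (b,j))"
      using i j by (intro sum.cong refl) (simp add: sig sum_distrib_left mult_ac)
    also have "\<dots> = (\<Sum>b<?d. \<Sum>a<?d. S $$ (i,a) * (\<Sum>g\<in>carrier G. f g * \<rho> g $$ (a,b)) * T $$ (b,j))"
      by (simp add: sum.swap[of _ _ "carrier G"] sum_distrib_left sum_distrib_right)
    also have "\<dots> = 0" using k d by (simp add: fourier_vanishes_def)
    finally show ?thesis .
  qed
  thus ?thesis by (simp add: fourier_vanishes_def)
qed

text \<open>
  Both sides, as functions of \<open>x\<^sup>-\<^sup>1\<close>, have the same Fourier transform at every irreducible
  representation: by orthogonality the left-hand side acts as \<open>|G|\<close> times the identity,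
  exactly as a point mass \<open>|G|\<close> at the unit does. Injectivity of the Fourier transform
  makes them equal.
\<close>

lemma (in finite_group) regular_character:
  assumes x: "x \<in> carrier G"
  shows "(\<Sum>C\<in>irreps G. of_nat (rep_dim G (rep_of C)) * character (rep_of C) x)
       = (if x = \<one> then of_nat (order G) else 0)"
proof -
  define F where "F g = (\<Sum>C\<in>irreps G. of_nat (rep_dim G (rep_of C)) * character (rep_of C) (inv g))
      - (if g = \<one> then of_nat (order G) else 0)" for g
  have kr: "fourier_vanishes G F (rep_of D)" if D: "D \<in> irreps G" for D
    unfolding fourier_vanishes_def
  proof (intro allI impI)
    let ?\<sigma> = "rep_of D"
    fix i j assume i: "i < rep_dim G ?\<sigma>" and j: "j < rep_dim G ?\<sigma>"
    have "(\<Sum>g\<in>carrier G. (\<Sum>C\<in>irreps G. of_nat (rep_dim G (rep_of C)) * character (rep_of C) (inv g)) * ?\<sigma> g $$ (i,j))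
        = (\<Sum>C\<in>irreps G. of_nat (rep_dim G (rep_of C)) * (\<Sum>g\<in>carrier G. character (rep_of C) (inv g) * ?\<sigma> g $$ (i,j)))"
      by (simp add: sum.swap[of _ _ "carrier G"] sum_distrib_left sum_distrib_right mult.assoc)
    also have "\<dots> = (\<Sum>C\<in>irreps G. if C = D then if i = j then of_nat (order G) else 0 else 0)"
    proof (intro sum.cong refl)
      fix C assume C: "C \<in> irreps G"
      show "of_nat (rep_dim G (rep_of C)) * (\<Sum>g\<in>carrier G. character (rep_of C) (inv g) * ?\<sigma> g $$ (i,j))
        = (if C = D then if i = j then of_nat (order G) else 0 else 0)"
        using entry_character_orthogonality[OF irreducible_rep_of[OF C] irreducible_rep_of[OF D] i j]
          rep_of_inequivalent[OF C D] rep_of_eq_iff[OF D C] by auto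
    qed
    also have "\<dots> = (if i = j then of_nat (order G) else 0)" using D finite_irreps by simp
    finally have 1: "(\<Sum>g\<in>carrier G. (\<Sum>C\<in>irreps G. of_nat (rep_dim G (rep_of C)) * character (rep_of C) (inv g)) * ?\<sigma> g $$ (i,j))
        = (if i = j then of_nat (order G) else 0)" .
    have "(\<Sum>g\<in>carrier G. (if g = \<one> then of_nat (order G) else 0) * ?\<sigma> g $$ (i,j)) = of_nat (order G) * ?\<sigma> \<one> $$ (i,j)"
      using fin by (simp add: if_distrib[of "\<lambda>x. x * _"] cong: if_cong)
    also have "\<dots> = (if i = j then of_nat (order G) else 0)"
      using i j representationD(2)[OF irreducible_repD(1)[OF irreducible_rep_of[OF D]]] by simp
    finally show "(\<Sum>g\<in>carrier G. F g * ?\<sigma> g $$ (i,j)) = 0"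
      unfolding F_def left_diff_distrib sum_subtractf 1 by simp
  qed
  have kill: "fourier_vanishes G F \<sigma>" if \<sigma>: "irreducible_rep G \<sigma>" for \<sigma>
  proof -
    obtain D where D: "D \<in> irreps G" "equivalent_reps G \<sigma> (rep_of D)" using ex_equivalent_rep_of[OF \<sigma>] .
    show ?thesis
      by (rule fourier_vanishes_equivalent[OF irreducible_repD(1)[OF irreducible_rep_of[OF D(1)]] irreducible_repD(1)[OF \<sigma>] D(2) kr[OF D(1)]])
  qed
  have "F (inv x) = 0" by (rule fourier_injective[OF kill]) (use x in auto)
  thus ?thesis using x by (simp add: F_def inv_eq_1_iff)
qed

lemma fourier_carrier: "fourier G \<phi> \<rho> \<in> carrier_mat (rep_dim G \<rho>) (rep_dim G \<rho>)"
  by (simp add: fourier_def)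

lemma (in finite_group) fourier_convol:
  assumes \<rho>: "representation G \<rho>"
  shows "fourier G (convol G \<alpha> \<beta>) \<rho> = fourier G \<alpha> \<rho> * fourier G \<beta> \<rho>"
proof (rule eq_matI)
  let ?d = "rep_dim G \<rho>"
  fix i j assume "i < dim_row (fourier G \<alpha> \<rho> * fourier G \<beta> \<rho>)" "j < dim_col (fourier G \<alpha> \<rho> * fourier G \<beta> \<rho>)"
  hence i: "i < ?d" and j: "j < ?d" by (auto simp: fourier_def)
  have "fourier G (convol G \<alpha> \<beta>) \<rho> $$ (i,j)
      = (\<Sum>g\<in>carrier G. \<Sum>x\<in>carrier G. of_real (\<alpha> g) * of_real (\<beta> (inv g \<otimes> x)) * \<rho> x $$ (i,j))"
    using i j by (subst sum.swap) (simp add: fourier_def convol_def sum_distrib_right)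
  also have "\<dots> = (\<Sum>g\<in>carrier G. \<Sum>x\<in>carrier G. of_real (\<alpha> g) * of_real (\<beta> (inv g \<otimes> (g \<otimes> x))) * \<rho> (g \<otimes> x) $$ (i,j))"
    by (intro sum.cong refl sum_translate[symmetric])
  also have "\<dots> = (\<Sum>g\<in>carrier G. \<Sum>x\<in>carrier G. \<Sum>l<?d. (of_real (\<alpha> g) * \<rho> g $$ (i,l)) * (of_real (\<beta> x) * \<rho> x $$ (l,j)))"
    by (intro sum.cong refl) (simp add: m_assoc[symmetric] rep_mult_entry[OF \<rho> _ _ i j] sum_distrib_left mult_ac)
  also have "\<dots> = (\<Sum>g\<in>carrier G. \<Sum>l<?d. \<Sum>x\<in>carrier G. (of_real (\<alpha> g) * \<rho> g $$ (i,l)) * (of_real (\<beta> x) * \<rho> x $$ (l,j)))"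
    by (intro sum.cong refl sum.swap)
  also have "\<dots> = (\<Sum>l<?d. \<Sum>g\<in>carrier G. \<Sum>x\<in>carrier G. (of_real (\<alpha> g) * \<rho> g $$ (i,l)) * (of_real (\<beta> x) * \<rho> x $$ (l,j)))"
    by (rule sum.swap)
  also have "\<dots> = (\<Sum>l<?d. (\<Sum>g\<in>carrier G. of_real (\<alpha> g) * \<rho> g $$ (i,l)) * (\<Sum>x\<in>carrier G. of_real (\<beta> x) * \<rho> x $$ (l,j)))"
    by (simp only: sum_product)
  also have "\<dots> = (fourier G \<alpha> \<rho> * fourier G \<beta> \<rho>) $$ (i,j)"
    unfolding mat_mult_sum[OF fourier_carrier fourier_carrier i j]
    using i j by (intro sum.cong) (auto simp: fourier_def)
  finally show "fourier G (convol G \<alpha> \<beta>) \<rho> $$ (i,j) = (fourier G \<alpha> \<rho> * fourier G \<beta> \<rho>) $$ (i,j)" .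
qed (auto simp: fourier_def)

lemma (in finite_group) fourier_convol_pow:
  assumes \<rho>: "representation G \<rho>"
  shows "fourier G (convol_pow G \<gamma> k) \<rho> = fourier G \<gamma> \<rho> ^\<^sub>m k"
proof (induction k)
  case 0
  have "fourier G (convol_pow G \<gamma> 0) \<rho> = \<rho> \<one>"
  proof (rule eq_matI)
    fix i j assume "i < dim_row (\<rho> \<one>)" "j < dim_col (\<rho> \<one>)"
    hence "i < rep_dim G \<rho>" "j < rep_dim G \<rho>" using representationD(1)[OF \<rho> one_closed] by auto
    thus "fourier G (convol_pow G \<gamma> 0) \<rho> $$ (i,j) = \<rho> \<one> $$ (i,j)"
      using fin by (simp add: fourier_def if_distrib[of "\<lambda>x. x * _"] if_distrib[of complex_of_real] cong: if_cong)
  qed (use representationD(1)[OF \<rho> one_closed] in \<open>auto simp: fourier_def\<close>)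
  thus ?case using representationD(2)[OF \<rho>] by (simp add: fourier_def)
next
  case (Suc k)
  thus ?case by (simp add: fourier_convol[OF \<rho>])
qed

lemma fourier_diff:
  "fourier G (\<lambda>x. \<alpha> x - \<beta> x) \<rho> = fourier G \<alpha> \<rho> - fourier G \<beta> \<rho>"
  by (rule eq_matI) (auto simp: fourier_def left_diff_distrib sum_subtractf)

lemma trace_fourier:
  assumes "representation G \<rho>"
  shows "mat_trace (fourier G \<phi> \<rho>) = (\<Sum>g\<in>carrier G. of_real (\<phi> g) * character \<rho> g)"
  using character_sum[OF assms] by (simp add: mat_trace_def fourier_def sum_distrib_left sum.swap[of _ _ "carrier G"])

text \<open>
  By multiplicativity \<open>tr ((\<Sum>\<^sub>g \<phi>(g) \<rho>(g))\<^sup>2) = \<Sum>\<^sub>g (\<phi> * \<phi>)(g) \<chi>\<^sub>\<rho>(g)\<close>, and summing over all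
  \<open>\<rho>\<close> with weights \<open>d\<^sub>\<rho>\<close> leaves \<open>|G| (\<phi> * \<phi>)(1)\<close>. For symmetric \<open>\<phi>\<close> this is the
  squared \<open>L\<^sup>2\<close> norm.
\<close>

lemma (in finite_group) plancherel_symmetric:
  assumes sym: "\<And>g. g \<in> carrier G \<Longrightarrow> \<phi> (inv g) = \<phi> g"
  shows "(\<Sum>C\<in>irreps G. of_nat (rep_dim G (rep_of C)) * mat_trace (fourier G \<phi> (rep_of C) ^\<^sub>m 2))
       = of_real (of_nat (order G) * (\<Sum>g\<in>carrier G. (\<phi> g)\<^sup>2))"
proof -
  let ?\<psi> = "convol G \<phi> \<phi>"
  have "(\<Sum>C\<in>irreps G. of_nat (rep_dim G (rep_of C)) * mat_trace (fourier G \<phi> (rep_of C) ^\<^sub>m 2))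
      = (\<Sum>C\<in>irreps G. of_nat (rep_dim G (rep_of C)) * (\<Sum>g\<in>carrier G. of_real (?\<psi> g) * character (rep_of C) g))"
  proof (intro sum.cong refl)
    fix C assume "C \<in> irreps G"
    note r = irreducible_repD(1)[OF irreducible_rep_of[OF this]]
    have "fourier G \<phi> (rep_of C) ^\<^sub>m 2 = fourier G ?\<psi> (rep_of C)"
      using fourier_carrier[of G \<phi> "rep_of C"] by (simp add: fourier_convol[OF r] numeral_2_eq_2)
    thus "of_nat (rep_dim G (rep_of C)) * mat_trace (fourier G \<phi> (rep_of C) ^\<^sub>m 2)
        = of_nat (rep_dim G (rep_of C)) * (\<Sum>g\<in>carrier G. of_real (?\<psi> g) * character (rep_of C) g)"
      by (simp add: trace_fourier[OF r])
  qed
  also have "\<dots> = (\<Sum>g\<in>carrier G. of_real (?\<psi> g) * (\<Sum>C\<in>irreps G. of_nat (rep_dim G (rep_of C)) * character (rep_of C) g))"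
    by (simp add: sum_distrib_left sum.swap[of _ _ "carrier G"] mult_ac)
  also have "\<dots> = (\<Sum>g\<in>carrier G. if g = \<one> then of_real (?\<psi> g) * of_nat (order G) else 0)"
    by (intro sum.cong) (auto simp: regular_character)
  also have "\<dots> = of_real (?\<psi> \<one> * of_nat (order G))" using fin by simp
  also have "?\<psi> \<one> = (\<Sum>g\<in>carrier G. (\<phi> g)\<^sup>2)"
    unfolding convol_def by (intro sum.cong) (auto simp: sym power2_eq_square)
  finally show ?thesis by (simp add: mult.commute)
qed

section \<open>Reversible walks are symmetric\<close>

lemma (in finite_group) kernel_sum_left:
  assumes supp: "set_pmf \<gamma> \<subseteq> carrier G" and y: "y \<in> carrier G"
  shows "(\<Sum>x\<in>carrier G. walk_kernel G \<gamma> x y) = 1"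
proof -
  have c: "y \<otimes> (inv y \<otimes> a) = a" if "a \<in> carrier G" for a
    using y that by (simp add: m_assoc[symmetric])
  have "(\<Sum>x\<in>carrier G. pmf \<gamma> (inv x \<otimes> y)) = (\<Sum>x\<in>carrier G. pmf \<gamma> x)"
    by (rule sum.reindex_bij_witness[of _ "\<lambda>x. y \<otimes> inv x" "\<lambda>x. inv x \<otimes> y"])
      (use y in \<open>auto simp: inv_mult_group m_assoc c\<close>)
  thus ?thesis using sum_pmf_eq_1[OF fin supp] by (simp add: walk_kernel_def)
qed

lemma (in finite_group) kernel_sum_right:
  assumes supp: "set_pmf \<gamma> \<subseteq> carrier G" and x: "x \<in> carrier G"
  shows "(\<Sum>y\<in>carrier G. walk_kernel G \<gamma> x y) = 1"
  using sum_translate[of "inv x" "pmf \<gamma>"] sum_pmf_eq_1[OF fin supp] x by (simp add: walk_kernel_def)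

lemma (in finite_group) kernel_pow_walk_nonneg:
  "kernel_pow (carrier G) (walk_kernel G \<gamma>) k x y \<ge> 0"
  by (induction k arbitrary: y) (auto simp: walk_kernel_def intro!: sum_nonneg)

text \<open>
  A maximum principle. By detailed balance \<open>\<pi>(y)\<close> is the average of \<open>\<pi>\<close> with weights
  \<open>P(\<cdot>, y)\<close>, which add up to one because the walk is doubly stochastic; hence the
  maximum of \<open>\<pi>\<close> propagates backwards along transitions, and by irreducibility everywhere.
\<close>

lemma (in finite_group) detailed_balance_constant:
  assumes supp: "set_pmf \<gamma> \<subseteq> carrier G"
    and irr: "irreducible_chain (carrier G) (walk_kernel G \<gamma>)"
    and bal: "\<And>x y. x \<in> carrier G \<Longrightarrow> y \<in> carrier G \<Longrightarrow>
      \<pi> x * walk_kernel G \<gamma> x y = \<pi> y * walk_kernel G \<gamma> y x"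
  obtains M :: real where "\<And>x. x \<in> carrier G \<Longrightarrow> \<pi> x = M"
proof -
  let ?P = "walk_kernel G \<gamma>"
  define M where "M = Max (\<pi> ` carrier G)"
  have le: "\<pi> x \<le> M" if "x \<in> carrier G" for x unfolding M_def using that fin by simp
  have "M \<in> \<pi> ` carrier G" unfolding M_def using fin by (intro Max_in) auto
  then obtain x0 where x0: "x0 \<in> carrier G" "\<pi> x0 = M" by auto
  have step: "\<pi> z = M" if z: "z \<in> carrier G" and y: "y \<in> carrier G" and My: "\<pi> y = M" and pos: "?P z y > 0" for z y
  proof (rule ccontr)
    assume "\<pi> z \<noteq> M"
    hence lt: "\<pi> z < M" using le[OF z] by simp
    have "M = (\<Sum>x\<in>carrier G. \<pi> y * ?P y x)"
      using kernel_sum_right[OF supp y] My by (simp add: sum_distrib_left[symmetric])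
    also have "\<dots> = (\<Sum>x\<in>carrier G. \<pi> x * ?P x y)" using bal y by (intro sum.cong) auto
    also have "\<dots> < (\<Sum>x\<in>carrier G. M * ?P x y)"
    proof (rule sum_strict_mono_ex1[OF fin])
      show "\<forall>x\<in>carrier G. \<pi> x * ?P x y \<le> M * ?P x y"
        using le by (auto simp: walk_kernel_def intro!: mult_right_mono)
      show "\<exists>x\<in>carrier G. \<pi> x * ?P x y < M * ?P x y"
        using z lt pos by (intro bexI[of _ z]) auto
    qed
    also have "\<dots> = M" using kernel_sum_left[OF supp y] by (simp add: sum_distrib_left[symmetric])
    finally show False by simp
  qed
  have reach: "\<pi> x = M" if "x \<in> carrier G" "y \<in> carrier G" "\<pi> y = M" "kernel_pow (carrier G) ?P k x y > 0" for x y k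
    using that(2-4)
  proof (induction k arbitrary: y)
    case 0
    thus ?case by (auto split: if_splits)
  next
    case (Suc k)
    have "(\<Sum>z\<in>carrier G. kernel_pow (carrier G) ?P k x z * ?P z y) \<noteq> 0" using Suc.prems by simp
    then obtain z where z: "z \<in> carrier G" "kernel_pow (carrier G) ?P k x z * ?P z y \<noteq> 0"
      by (meson sum.not_neutral_contains_not_neutral)
    hence "kernel_pow (carrier G) ?P k x z > 0" "?P z y > 0"
      using kernel_pow_walk_nonneg[of \<gamma> k x z] by (auto simp: walk_kernel_def less_le)
    thus ?case using Suc.IH[OF z(1)] step[OF z(1) Suc.prems(1,2)] by simp
  qed
  have "\<pi> x = M" if "x \<in> carrier G" for x
    using irr x0 that reach[OF that x0] unfolding irreducible_chain_def by blast
  thus ?thesis using that by blast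
qed

text \<open>
  The reversing distribution is uniform, so detailed balance between \<open>g\<close> and the unit is
  the claim.
\<close>

lemma (in finite_group) reversible_walk_symmetric:
  assumes supp: "set_pmf \<gamma> \<subseteq> carrier G"
    and irr: "irreducible_chain (carrier G) (walk_kernel G \<gamma>)"
    and rev: "reversible_chain (carrier G) (walk_kernel G \<gamma>)"
    and g: "g \<in> carrier G"
  shows "pmf \<gamma> (inv g) = pmf \<gamma> g"
proof -
  obtain \<pi> where \<pi>: "(\<Sum>x\<in>carrier G. \<pi> x) = 1"
    and bal: "\<And>x y. x \<in> carrier G \<Longrightarrow> y \<in> carrier G \<Longrightarrow> \<pi> x * walk_kernel G \<gamma> x y = \<pi> y * walk_kernel G \<gamma> y x"
    using rev unfolding reversible_chain_def by blast
  obtain M where M: "\<And>x. x \<in> carrier G \<Longrightarrow> \<pi> x = M"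
    using detailed_balance_constant[OF supp irr bal] by blast
  have "M \<noteq> 0" using \<pi> M by auto
  thus ?thesis using bal[OF g one_closed] g M by (simp add: walk_kernel_def)
qed

lemma (in finite_group) convol_assoc:
  assumes x: "x \<in> carrier G"
  shows "convol G (convol G \<alpha> \<beta>) \<gamma> x = convol G \<alpha> (convol G \<beta> \<gamma>) x"
proof -
  have "convol G (convol G \<alpha> \<beta>) \<gamma> x
      = (\<Sum>h\<in>carrier G. \<Sum>g\<in>carrier G. \<alpha> g * (\<beta> (inv g \<otimes> h) * \<gamma> (inv h \<otimes> x)))"
    by (simp add: convol_def sum_distrib_right mult.assoc)
  also have "\<dots> = (\<Sum>g\<in>carrier G. \<Sum>h\<in>carrier G. \<alpha> g * (\<beta> (inv g \<otimes> h) * \<gamma> (inv h \<otimes> x)))"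
    by (rule sum.swap)
  also have "\<dots> = (\<Sum>g\<in>carrier G. \<Sum>h\<in>carrier G. \<alpha> g * (\<beta> (inv g \<otimes> (g \<otimes> h)) * \<gamma> (inv (g \<otimes> h) \<otimes> x)))"
    by (intro sum.cong refl sum_translate[symmetric])
  also have "\<dots> = convol G \<alpha> (convol G \<beta> \<gamma>) x"
    unfolding convol_def sum_distrib_left
    using x by (intro sum.cong refl) (simp add: m_assoc[symmetric] inv_mult_group)
  finally show ?thesis .
qed

lemma convol_cong:
  assumes "\<And>g. g \<in> carrier G \<Longrightarrow> \<alpha> g = \<alpha>' g"
  shows "convol G \<alpha> \<beta> x = convol G \<alpha>' \<beta> x"
  unfolding convol_def using assms by simp

lemma (in finite_group) convol_pow_Suc_left:
  assumes "x \<in> carrier G"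
  shows "convol_pow G \<gamma> (Suc k) x = convol G \<gamma> (convol_pow G \<gamma> k) x"
  using assms
proof (induction k arbitrary: x)
  case 0
  have "convol_pow G \<gamma> (Suc 0) x = \<gamma> x"
    using 0 fin by (simp add: convol_def if_distrib[of "\<lambda>a. a * _"] cong: if_cong)
  also have "\<dots> = (\<Sum>g\<in>carrier G. if g = x then \<gamma> g else 0)" using 0 fin by simp
  also have "\<dots> = convol G \<gamma> (convol_pow G \<gamma> 0) x"
    unfolding convol_def
  proof (intro sum.cong refl)
    fix g assume g: "g \<in> carrier G"
    have "inv g \<otimes> x = \<one> \<longleftrightarrow> g = x" using g 0 by (metis inv_closed inv_equality inv_inv l_inv)
    thus "(if g = x then \<gamma> g else 0) = \<gamma> g * convol_pow G \<gamma> 0 (inv g \<otimes> x)" by simp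
  qed
  finally show ?case .
next
  case (Suc k)
  have "convol_pow G \<gamma> (Suc (Suc k)) x = convol G (convol_pow G \<gamma> (Suc k)) \<gamma> x" by simp
  also have "\<dots> = convol G (convol G \<gamma> (convol_pow G \<gamma> k)) \<gamma> x" by (rule convol_cong) (rule Suc.IH)
  also have "\<dots> = convol G \<gamma> (convol_pow G \<gamma> (Suc k)) x" by (simp add: convol_assoc[OF Suc.prems])
  finally show ?case .
qed

text \<open>
  Inversion reverses the order of a convolution product, which is harmless because
  the powers of a single function commute.
\<close>

lemma (in finite_group) convol_pow_symmetric:
  assumes sym: "\<And>g. g \<in> carrier G \<Longrightarrow> \<gamma> (inv g) = \<gamma> g" and x: "x \<in> carrier G"
  shows "convol_pow G \<gamma> k (inv x) = convol_pow G \<gamma> k x"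
  using x
proof (induction k arbitrary: x)
  case (Suc k)
  have "convol_pow G \<gamma> (Suc k) (inv x) = (\<Sum>g\<in>carrier G. convol_pow G \<gamma> k g * \<gamma> (x \<otimes> g))"
    using Suc.prems by (simp add: convol_def inv_mult_group[symmetric] sym)
  also have "\<dots> = (\<Sum>g\<in>carrier G. \<gamma> (x \<otimes> g) * convol_pow G \<gamma> k (inv (x \<otimes> g) \<otimes> x))"
    using Suc by (intro sum.cong refl) (simp add: inv_mult_group m_assoc)
  also have "\<dots> = convol G \<gamma> (convol_pow G \<gamma> k) x"
    unfolding convol_def by (rule sum_translate[OF Suc.prems])
  also have "\<dots> = convol_pow G \<gamma> (Suc k) x" by (rule convol_pow_Suc_left[OF Suc.prems, symmetric])
  finally show ?case .
qed auto

section \<open>Comparison of total variation distances\<close>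

text \<open>
  Triangle inequality and Cauchy-Schwarz.
\<close>

lemma tv_dist_diff_le:
  fixes p q u :: "'a \<Rightarrow> real"
  assumes fin: "finite \<Omega>"
  shows "\<bar>tv_dist \<Omega> p u - tv_dist \<Omega> q u\<bar> \<le> sqrt (card \<Omega> * (\<Sum>\<omega>\<in>\<Omega>. (p \<omega> - q \<omega>)\<^sup>2)) / 2"
proof -
  have "\<bar>tv_dist \<Omega> p u - tv_dist \<Omega> q u\<bar> = \<bar>\<Sum>\<omega>\<in>\<Omega>. \<bar>p \<omega> - u \<omega>\<bar> - \<bar>q \<omega> - u \<omega>\<bar>\<bar> / 2"
    by (simp add: tv_dist_def sum_subtractf diff_divide_distrib[symmetric])
  also have "\<dots> \<le> (\<Sum>\<omega>\<in>\<Omega>. \<bar>p \<omega> - q \<omega>\<bar>) / 2"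
    by (intro divide_right_mono order.trans[OF sum_abs] sum_mono) auto
  also have "(\<Sum>\<omega>\<in>\<Omega>. \<bar>p \<omega> - q \<omega>\<bar>) \<le> sqrt (card \<Omega> * (\<Sum>\<omega>\<in>\<Omega>. (p \<omega> - q \<omega>)\<^sup>2))"
    using L2_set_mult_ineq[of "\<lambda>_. 1 :: real" "\<lambda>\<omega>. p \<omega> - q \<omega>" \<Omega>]
    by (simp add: L2_set_def real_sqrt_mult)
  finally show ?thesis by simp
qed

lemma (in finite_group) walk_tv_comparison:
  assumes sym: "\<And>g. g \<in> carrier G \<Longrightarrow> pmf \<nu> (inv g) = pmf \<nu> g"
      "\<And>g. g \<in> carrier G \<Longrightarrow> pmf \<mu> (inv g) = pmf \<mu> g"
  shows "\<bar>walk_tv G \<mu> l - walk_tv G \<nu> k\<bar> \<le> sqrt (cmod (\<Sum>C\<in>irreps G. let \<rho> = rep_of C in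
            of_nat (rep_dim G \<rho>) *
            mat_trace ((fourier G (pmf \<nu>) \<rho> ^\<^sub>m k - fourier G (pmf \<mu>) \<rho> ^\<^sub>m l) ^\<^sub>m 2))) / 2"
proof -
  let ?\<phi> = "\<lambda>x. convol_pow G (pmf \<nu>) k x - convol_pow G (pmf \<mu>) l x"
  have "(\<Sum>C\<in>irreps G. let \<rho> = rep_of C in of_nat (rep_dim G \<rho>) *
            mat_trace ((fourier G (pmf \<nu>) \<rho> ^\<^sub>m k - fourier G (pmf \<mu>) \<rho> ^\<^sub>m l) ^\<^sub>m 2))
      = (\<Sum>C\<in>irreps G. of_nat (rep_dim G (rep_of C)) * mat_trace (fourier G ?\<phi> (rep_of C) ^\<^sub>m 2))"
  proof (intro sum.cong refl)
    fix C assume "C \<in> irreps G"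
    note r = irreducible_repD(1)[OF irreducible_rep_of[OF this]]
    show "(let \<rho> = rep_of C in of_nat (rep_dim G \<rho>) *
            mat_trace ((fourier G (pmf \<nu>) \<rho> ^\<^sub>m k - fourier G (pmf \<mu>) \<rho> ^\<^sub>m l) ^\<^sub>m 2))
        = of_nat (rep_dim G (rep_of C)) * mat_trace (fourier G ?\<phi> (rep_of C) ^\<^sub>m 2)"
      by (simp add: Let_def fourier_diff fourier_convol_pow[OF r])
  qed
  also have "\<dots> = of_real (of_nat (order G) * (\<Sum>g\<in>carrier G. (?\<phi> g)\<^sup>2))"
    by (rule plancherel_symmetric) (simp add: convol_pow_symmetric[where \<gamma> = "pmf \<nu>", OF sym(1)]
      convol_pow_symmetric[where \<gamma> = "pmf \<mu>", OF sym(2)])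
  finally have "cmod (\<Sum>C\<in>irreps G. let \<rho> = rep_of C in of_nat (rep_dim G \<rho>) *
            mat_trace ((fourier G (pmf \<nu>) \<rho> ^\<^sub>m k - fourier G (pmf \<mu>) \<rho> ^\<^sub>m l) ^\<^sub>m 2))
      = of_nat (order G) * (\<Sum>g\<in>carrier G. (?\<phi> g)\<^sup>2)"
    by (simp only: norm_of_real abs_of_nonneg[OF mult_nonneg_nonneg[OF of_nat_0_le_iff sum_nonneg[OF zero_le_power2]]])
  thus ?thesis
    using tv_dist_diff_le[OF fin, of "convol_pow G (pmf \<nu>) k" "pmf (pmf_of_set (carrier G))" "convol_pow G (pmf \<mu>) l"]
    by (simp add: walk_tv_def order_def abs_minus_commute)
qed

lemma tv_transition_cong_profile:
  assumes \<nu>: "has_limit_profile G \<nu> \<tau> w f" and \<mu>: "has_limit_profile G \<mu> \<tau>' w' f"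
    and trans: "tv_transition G \<nu> \<tau> w"
  shows "tv_transition G \<mu> \<tau>' w'"
proof -
  have lim: "(\<lambda>n. ereal (walk_tv (G n) (\<gamma> n) (cutoff_step t u c n))) \<longlonglongrightarrow> ereal (f c)"
    if "has_limit_profile G \<gamma> t u f" for \<gamma> t u c
    using that by (simp add: has_limit_profile_def)
  have "liminf (\<lambda>n. ereal (walk_tv (G n) (\<gamma> n) (cutoff_step t u c n))) = ereal (f c)"
       "limsup (\<lambda>n. ereal (walk_tv (G n) (\<gamma> n) (cutoff_step t u c n))) = ereal (f c)"
    if "has_limit_profile G \<gamma> t u f" for \<gamma> t u c
    using lim[OF that, of c] by (simp_all add: lim_imp_Liminf lim_imp_Limsup)
  thus ?thesis using trans \<nu> \<mu> unfolding tv_transition_def by simp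
qed

text \<open>
  The profile of \<open>\<mu>\<close> comes from the comparison of distances, and the two
  total variation clauses depend on a walk only through its profile.
\<close>

theorem theorem2p1:
  fixes G :: "nat \<Rightarrow> 'a monoid"
    and \<nu> \<mu> :: "nat \<Rightarrow> 'a pmf"
    and \<tau>\<^sub>\<nu> w\<^sub>\<nu> \<tau>\<^sub>\<mu> w\<^sub>\<mu> :: "nat \<Rightarrow> real"
    and f :: "real \<Rightarrow> real"
  assumes "\<And>n. n \<ge> 1 \<Longrightarrow> group (G n)"
    and "\<And>n. n \<ge> 1 \<Longrightarrow> finite (carrier (G n))"
    and "\<And>n. n \<ge> 1 \<Longrightarrow> set_pmf (\<nu> n) \<subseteq> carrier (G n)"
    and "\<And>n. n \<ge> 1 \<Longrightarrow> set_pmf (\<mu> n) \<subseteq> carrier (G n)"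
    and "\<And>n. n \<ge> 1 \<Longrightarrow> irreducible_chain (carrier (G n)) (walk_kernel (G n) (\<nu> n))"
    and "\<And>n. n \<ge> 1 \<Longrightarrow> aperiodic_chain (carrier (G n)) (walk_kernel (G n) (\<nu> n))"
    and "\<And>n. n \<ge> 1 \<Longrightarrow> reversible_chain (carrier (G n)) (walk_kernel (G n) (\<nu> n))"
    and "\<And>n. n \<ge> 1 \<Longrightarrow> irreducible_chain (carrier (G n)) (walk_kernel (G n) (\<mu> n))"
    and "\<And>n. n \<ge> 1 \<Longrightarrow> aperiodic_chain (carrier (G n)) (walk_kernel (G n) (\<mu> n))"
    and "\<And>n. n \<ge> 1 \<Longrightarrow> reversible_chain (carrier (G n)) (walk_kernel (G n) (\<mu> n))"
    and "tv_cutoff G \<nu> \<tau>\<^sub>\<nu> w\<^sub>\<nu>"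
    and "has_limit_profile G \<nu> \<tau>\<^sub>\<nu> w\<^sub>\<nu> f"
    and "w\<^sub>\<mu> \<in> o(\<tau>\<^sub>\<mu>)"
    and "\<And>c. (\<lambda>n. \<Sum>C\<in>irreps (G n). let \<rho> = rep_of C in
            of_nat (rep_dim (G n) \<rho>) *
            mat_trace ((fourier (G n) (pmf (\<nu> n)) \<rho> ^\<^sub>m cutoff_step \<tau>\<^sub>\<nu> w\<^sub>\<nu> c n -
                        fourier (G n) (pmf (\<mu> n)) \<rho> ^\<^sub>m cutoff_step \<tau>\<^sub>\<mu> w\<^sub>\<mu> c n) ^\<^sub>m 2))
          \<longlonglongrightarrow> 0"
  shows "tv_transition G \<mu> \<tau>\<^sub>\<mu> w\<^sub>\<mu> \<and>
         (filterlim \<tau>\<^sub>\<mu> at_top sequentially \<longrightarrow> tv_cutoff G \<mu> \<tau>\<^sub>\<mu> w\<^sub>\<mu>) \<and>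
         has_limit_profile G \<mu> \<tau>\<^sub>\<mu> w\<^sub>\<mu> f"
proof -
  have profile: "has_limit_profile G \<mu> \<tau>\<^sub>\<mu> w\<^sub>\<mu> f"
    unfolding has_limit_profile_def
  proof
    fix c
    let ?S = "\<lambda>n. \<Sum>C\<in>irreps (G n). let \<rho> = rep_of C in
            of_nat (rep_dim (G n) \<rho>) *
            mat_trace ((fourier (G n) (pmf (\<nu> n)) \<rho> ^\<^sub>m cutoff_step \<tau>\<^sub>\<nu> w\<^sub>\<nu> c n -
                        fourier (G n) (pmf (\<mu> n)) \<rho> ^\<^sub>m cutoff_step \<tau>\<^sub>\<mu> w\<^sub>\<mu> c n) ^\<^sub>m 2)"
    let ?a = "\<lambda>n. walk_tv (G n) (\<mu> n) (cutoff_step \<tau>\<^sub>\<mu> w\<^sub>\<mu> c n)"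
    let ?b = "\<lambda>n. walk_tv (G n) (\<nu> n) (cutoff_step \<tau>\<^sub>\<nu> w\<^sub>\<nu> c n)"
    have "\<bar>?a n - ?b n\<bar> \<le> sqrt (cmod (?S n)) / 2" if n: "n \<ge> 1" for n
    proof -
      interpret finite_group "G n"
        by (rule finite_group.intro[OF assms(1)[OF n]]) (unfold_locales, rule assms(2)[OF n])
      show ?thesis
        by (rule walk_tv_comparison;
            rule reversible_walk_symmetric[OF assms(3)[OF n] assms(5)[OF n] assms(7)[OF n]]
              reversible_walk_symmetric[OF assms(4)[OF n] assms(8)[OF n] assms(10)[OF n]])
    qed
    hence "\<forall>\<^sub>F n in sequentially. norm (?a n - ?b n) \<le> sqrt (cmod (?S n)) / 2"
      by (auto simp: eventually_sequentially)
    moreover have "(\<lambda>n. sqrt (cmod (?S n)) / 2) \<longlonglongrightarrow> sqrt (cmod 0) / 2"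
      by (intro tendsto_intros assms(14)) simp
    hence "(\<lambda>n. sqrt (cmod (?S n)) / 2) \<longlonglongrightarrow> 0" by simp
    ultimately have "(\<lambda>n. ?a n - ?b n) \<longlonglongrightarrow> 0" by (rule Lim_null_comparison)
    moreover have "?b \<longlonglongrightarrow> f c" using assms(12) by (simp add: has_limit_profile_def)
    ultimately have "(\<lambda>n. (?a n - ?b n) + ?b n) \<longlonglongrightarrow> 0 + f c" by (rule tendsto_add)
    thus "?a \<longlonglongrightarrow> f c" by simp
  qed
  moreover have "tv_transition G \<mu> \<tau>\<^sub>\<mu> w\<^sub>\<mu>"
    using tv_transition_cong_profile[OF assms(12) profile] assms(11) by (simp add: tv_cutoff_def)
  ultimately show ?thesis using assms(13) by (simp add: tv_cutoff_def)
qed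

end
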